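(* Let $E,F$ be complex Banach spaces, $U$ an open subset of $E$, $1<p\leq\infty$ and $f\in\mathcal{H}^\infty(U,F)$. The following conditions are equivalent: (i) $f\colon U\to F$ is Cohen strongly $p$-summing holomorphic. (ii) $T_f\colon\mathcal{G}^\infty(U)\to F$ is strongly $p$-summing. In this case, $d_p(T_f)=d_p^{\mathcal{H}^\infty}(f)$. Furthermore, the mapping $f\mapsto T_f$ is an isometric isomorphism from $(\mathcal{D}_p^{\mathcal{H}^\infty}(U,F),d_p^{\mathcal{H}^\infty})$ onto $(\mathcal{D}_p(\mathcal{G}^\infty(U),F),d_p)$.
   Context: $\mathcal{H}^\infty(U,F)$ is the Banach space of bounded holomorphic mappings $U\to F$ with the supremum norm, $\mathcal{H}^\infty(U)=\mathcal{H}^\infty(U,\mathbb{C})$. $\mathcal{G}^\infty(U)$ is the norm-closed linear span in $\mathcal{H}^\infty(U)^*$ of the evaluations $\delta(x)$, $x\in U$, and $g_U\colon U\to\mathcal{G}^\infty(U)$ is $g_U(x)=\delta(x)$. For $f\in\mathcal{H}^\infty(U,F)$, $T_f\in\mathcal{L}(\mathcal{G}^\infty(U),F)$ is the unique bounded linear operator with $T_f\circ g_U=f$ (Mujica's linearization; $\|T_f\|=\|f\|_\infty$). $p^*$ is the conjugate index of $p$ ($\infty^*=1$). For a normed space $X$: $\|(x_i)_{i=1}^n\|_{\ell_p^n(X)}=(\sum_i\|x_i\|^p)^{1/p}$ ($\max_i\|x_i\|$ if $p=\infty$), $\ell_p^n=\ell_p^n(\mathbb{C})$; $\|(y_i^*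 )_{i=1}^n\|_{\ell_{p^*}^{n,w}(F^* )}=\sup_{y^{**}\in B_{F^{**}}}(\sum_i|y^{**}(y_i^* )|^{p^*})^{1/p^*}$, with $B_X$ the closed unit ball of $X$. Holomorphic $f\colon U\to F$ is Cohen strongly $p$-summing if there is $C\geq0$ with $\sum_{i=1}^n|\lambda_i||\langle y_i^*,f(x_i)\rangle|\leq C\|(\lambda_i)\|_{\ell_p^n}\|(y_i^* )\|_{\ell_{p^*}^{n,w}(F^* )}$ for all $n\in\mathbb{N}$, $\lambda_i\in\mathbb{C}$, $x_i\in U$, $y_i^*\in F^*$; $d_p^{\mathcal{H}^\infty}(f)$ is the infimum of such $C$ and $\mathcal{D}_p^{\mathcal{H}^\infty}(U,F)$ the space of such mappings. A bounded linear operator $T\colon X\to F$ between Banach spaces is strongly $p$-summing if there is $C\geq0$ with $\sum_{i=1}^n|\langle y_i^*,T(x_i)\rangle|\leq C\|(x_i)\|_{\ell_p^n(X)}\|(y_i^* )\|_{\ell_{p^*}^{n,w}(F^* )}$ for all $n\in\mathbb{N}$, $x_i\in X$, $y_i^*\in F^*$; $d_p(T)$ is the infimum of such $C$ and $\mathcal{D}_p(X,F)$ the space of such operators. *)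

theory Defs
  imports "HOL-Analysis.Analysis" "HOL-Library.Function_Algebras"
begin

text \<open>
  Complex Banach spaces are types. Spaces that depend on the open set \<open>U\<close>, and all duals,
  are pairs of a carrier set \<open>V\<close> and a norm \<open>N\<close> on it inside a function type, with the pointwise
  operations. A map defined on a set (an operator on \<open>V\<close>, a function on \<open>U\<close>) is represented by
  the total function extending it by zero, so that such maps are equal iff they agree on the set.
\<close>

class scaleC =
  fixes scaleC :: "complex \<Rightarrow> 'a \<Rightarrow> 'a" (infixr "*\<^sub>C" 75)

class complex_vector = scaleC + ab_group_add +
  assumes scaleC_add_right: "a *\<^sub>C (x + y) = a *\<^sub>C x + a *\<^sub>C y"
    and scaleC_add_left: "(a + b) *\<^sub>C x = a *\<^sub>C x + b *\<^sub>C x"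
    and scaleC_scaleC: "a *\<^sub>C b *\<^sub>C x = (a * b) *\<^sub>C x"
    and scaleC_one: "1 *\<^sub>C x = x"

class complex_normed_vector = complex_vector + real_normed_vector +
  assumes scaleR_eq_scaleC: "r *\<^sub>R x = complex_of_real r *\<^sub>C x"
    and norm_scaleC: "norm (a *\<^sub>C x) = cmod a * norm x"

class complex_banach = complex_normed_vector + banach

global_interpretation complex_vector: vector_space "scaleC :: complex \<Rightarrow> 'a \<Rightarrow> 'a::complex_vector"
  by standard (simp_all add: scaleC_add_right scaleC_add_left scaleC_scaleC scaleC_one)

instantiation complex :: complex_banach
begin

definition scaleC_complex :: "complex \<Rightarrow> complex \<Rightarrow> complex" where
  "scaleC_complex a x = a * x"

instance
  by standard (simp_all add: scaleC_complex_def algebra_simps norm_mult scaleR_conv_of_real)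

end

instantiation "fun" :: (type, complex_vector) complex_vector
begin

definition scaleC_fun :: "complex \<Rightarrow> ('a \<Rightarrow> 'b) \<Rightarrow> 'a \<Rightarrow> 'b" where
  "scaleC_fun a f = (\<lambda>x. a *\<^sub>C f x)"

instance
  by standard
    (simp_all add: scaleC_fun_def fun_eq_iff scaleC_add_right scaleC_add_left scaleC_scaleC scaleC_one)

end


section \<open>Normed spaces on carriers\<close>

definition normed_space_on :: "'v::complex_vector set \<Rightarrow> ('v \<Rightarrow> real) \<Rightarrow> bool" where
  "normed_space_on V N \<longleftrightarrow>
    complex_vector.subspace V \<and>
    (\<forall>x\<in>V. 0 \<le> N x \<and> (N x = 0 \<longleftrightarrow> x = 0)) \<and>
    (\<forall>x\<in>V. \<forall>y\<in>V. N (x + y) \<le> N x + N y) \<and>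
    (\<forall>a. \<forall>x\<in>V. N (a *\<^sub>C x) = cmod a * N x)"

definition clinear_on :: "'v::complex_vector set \<Rightarrow> ('v \<Rightarrow> 'w::complex_vector) \<Rightarrow> bool" where
  "clinear_on V T \<longleftrightarrow>
    (\<forall>x\<in>V. \<forall>y\<in>V. T (x + y) = T x + T y) \<and> (\<forall>a. \<forall>x\<in>V. T (a *\<^sub>C x) = a *\<^sub>C T x)"

definition bounded_ops ::
    "'v::complex_vector set \<Rightarrow> ('v \<Rightarrow> real) \<Rightarrow> ('v \<Rightarrow> 'w::complex_normed_vector) set" where
  "bounded_ops V N =
    {T. clinear_on V T \<and> (\<exists>K. \<forall>x\<in>V. norm (T x) \<le> K * N x) \<and> (\<forall>x. x \<notin> V \<longrightarrow> T x = 0)}"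

definition op_norm ::
    "'v::complex_vector set \<Rightarrow> ('v \<Rightarrow> real) \<Rightarrow> ('v \<Rightarrow> 'w::complex_normed_vector) \<Rightarrow> real" where
  "op_norm V N T = Sup ((\<lambda>x. norm (T x)) ` {x \<in> V. N x \<le> 1})"

definition dual :: "'v::complex_vector set \<Rightarrow> ('v \<Rightarrow> real) \<Rightarrow> ('v \<Rightarrow> complex) set" where
  "dual V N = bounded_ops V N"

definition dual_norm ::
    "'v::complex_vector set \<Rightarrow> ('v \<Rightarrow> real) \<Rightarrow> ('v \<Rightarrow> complex) \<Rightarrow> real" where
  "dual_norm V N = op_norm V N"

definition isometric_isomorphism ::
    "'v::complex_vector set \<Rightarrow> ('v \<Rightarrow> real) \<Rightarrow> 'w::complex_vector set \<Rightarrow> ('w \<Rightarrow> real) \<Rightarrow>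
     ('v \<Rightarrow> 'w) \<Rightarrow> bool" where
  "isometric_isomorphism V N W M \<Phi> \<longleftrightarrow>
    normed_space_on V N \<and> normed_space_on W M \<and>
    clinear_on V \<Phi> \<and> bij_betw \<Phi> V W \<and> (\<forall>x\<in>V. M (\<Phi> x) = N x)"


section \<open>Norms of finite sequences\<close>

definition conjugate_index :: "ereal \<Rightarrow> ereal" where
  "conjugate_index p = (if p = \<infinity> then 1 else if p = 1 then \<infinity> else p / (p - 1))"

text \<open>Sequences of length \<open>n\<close> are functions on \<open>nat\<close> read on \<open>{..<n}\<close>; the inserted \<open>0\<close> only
  gives the empty sequence norm \<open>0\<close>.\<close>

definition lp_norm :: "('v \<Rightarrow> real) \<Rightarrow> ereal \<Rightarrow> nat \<Rightarrow> (nat \<Rightarrow> 'v) \<Rightarrow> real" where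
  "lp_norm N p n x =
    (if p = \<infinity> then Max (insert 0 ((\<lambda>i. N (x i)) ` {..<n}))
     else (\<Sum>i<n. N (x i) powr real_of_ereal p) powr (1 / real_of_ereal p))"

definition weak_lp_norm ::
    "'v::complex_vector set \<Rightarrow> ('v \<Rightarrow> real) \<Rightarrow> ereal \<Rightarrow> nat \<Rightarrow> (nat \<Rightarrow> 'v) \<Rightarrow> real" where
  "weak_lp_norm V N p n y =
    Sup ((\<lambda>\<eta>. lp_norm cmod p n (\<lambda>i. \<eta> (y i))) ` {\<eta> \<in> dual V N. dual_norm V N \<eta> \<le> 1})"


section \<open>Strongly summing operators\<close>

definition strongly_summing_const ::
    "ereal \<Rightarrow> 'v::complex_vector set \<Rightarrow> ('v \<Rightarrow> real) \<Rightarrow> ('v \<Rightarrow> 'f::complex_banach) \<Rightarrow> real \<Rightarrow> bool" where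
  "strongly_summing_const p V N T C \<longleftrightarrow>
    0 \<le> C \<and>
    (\<forall>n x (y :: nat \<Rightarrow> 'f \<Rightarrow> complex).
      (\<forall>i<n. x i \<in> V) \<longrightarrow> (\<forall>i<n. y i \<in> dual UNIV norm) \<longrightarrow>
      (\<Sum>i<n. cmod (y i (T (x i)))) \<le>
        C * lp_norm N p n x *
        weak_lp_norm (dual UNIV norm) (dual_norm UNIV norm) (conjugate_index p) n y)"

definition strongly_summing ::
    "ereal \<Rightarrow> 'v::complex_vector set \<Rightarrow> ('v \<Rightarrow> real) \<Rightarrow> ('v \<Rightarrow> 'f::complex_banach) \<Rightarrow> bool" where
  "strongly_summing p V N T \<longleftrightarrow> T \<in> bounded_ops V N \<and> (\<exists>C. strongly_summing_const p V N T C)"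

definition strongly_summing_norm ::
    "ereal \<Rightarrow> 'v::complex_vector set \<Rightarrow> ('v \<Rightarrow> real) \<Rightarrow> ('v \<Rightarrow> 'f::complex_banach) \<Rightarrow> real" where
  "strongly_summing_norm p V N T = Inf {C. strongly_summing_const p V N T C}"


section \<open>Holomorphic mappings and their linearization\<close>

text \<open>Holomorphy is complex Frechet differentiability: the real Frechet derivative of
  the library is required to be complex linear.\<close>

definition hol :: "'e::complex_banach set \<Rightarrow> ('e \<Rightarrow> 'f::complex_banach) set" where
  "hol U =
    {f. (\<forall>x\<in>U. \<exists>A. clinear_on UNIV A \<and> (f has_derivative A) (at x)) \<and> (\<forall>x. x \<notin> U \<longrightarrow> f x = 0)}"

definition hol_bdd :: "'e::complex_banach set \<Rightarrow> ('e \<Rightarrow> 'f::complex_banach) set" where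
  "hol_bdd U = {f \<in> hol U. bounded (f ` U)}"

text \<open>The inserted \<open>0\<close> makes the norm \<open>0\<close> when \<open>U\<close> is empty.\<close>

definition sup_norm :: "'e::complex_banach set \<Rightarrow> ('e \<Rightarrow> 'f::complex_banach) \<Rightarrow> real" where
  "sup_norm U f = Sup (insert 0 ((\<lambda>x. norm (f x)) ` U))"

definition evaluation :: "'e::complex_banach set \<Rightarrow> 'e \<Rightarrow> ('e \<Rightarrow> complex) \<Rightarrow> complex" where
  "evaluation U x = (\<lambda>h. if h \<in> hol_bdd U then h x else 0)"

definition G_norm :: "'e::complex_banach set \<Rightarrow> (('e \<Rightarrow> complex) \<Rightarrow> complex) \<Rightarrow> real" where
  "G_norm U = dual_norm (hol_bdd U) (sup_norm U)"

definition G_space :: "'e::complex_banach set \<Rightarrow> (('e \<Rightarrow> complex) \<Rightarrow> complex) set" where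
  "G_space U =
    {\<phi> \<in> dual (hol_bdd U) (sup_norm U).
      \<forall>\<epsilon>>0. \<exists>\<psi>\<in>complex_vector.span (evaluation U ` U). G_norm U (\<phi> - \<psi>) < \<epsilon>}"

definition linearization ::
    "'e::complex_banach set \<Rightarrow> ('e \<Rightarrow> 'f::complex_banach) \<Rightarrow> (('e \<Rightarrow> complex) \<Rightarrow> complex) \<Rightarrow> 'f" where
  "linearization U f =
    (THE T. T \<in> bounded_ops (G_space U) (G_norm U) \<and> (\<forall>x\<in>U. T (evaluation U x) = f x))"


section \<open>Cohen strongly summing holomorphic mappings\<close>

definition cohen_const ::
    "ereal \<Rightarrow> 'e::complex_banach set \<Rightarrow> ('e \<Rightarrow> 'f::complex_banach) \<Rightarrow> real \<Rightarrow> bool" where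
  "cohen_const p U f C \<longleftrightarrow>
    0 \<le> C \<and>
    (\<forall>n (l :: nat \<Rightarrow> complex) x (y :: nat \<Rightarrow> 'f \<Rightarrow> complex).
      (\<forall>i<n. x i \<in> U) \<longrightarrow> (\<forall>i<n. y i \<in> dual UNIV norm) \<longrightarrow>
      (\<Sum>i<n. cmod (l i) * cmod (y i (f (x i)))) \<le>
        C * lp_norm cmod p n l *
        weak_lp_norm (dual UNIV norm) (dual_norm UNIV norm) (conjugate_index p) n y)"

definition cohen_summing ::
    "ereal \<Rightarrow> 'e::complex_banach set \<Rightarrow> ('e \<Rightarrow> 'f::complex_banach) \<Rightarrow> bool" where
  "cohen_summing p U f \<longleftrightarrow> f \<in> hol U \<and> (\<exists>C. cohen_const p U f C)"

definition cohen_norm ::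
    "ereal \<Rightarrow> 'e::complex_banach set \<Rightarrow> ('e \<Rightarrow> 'f::complex_banach) \<Rightarrow> real" where
  "cohen_norm p U f = Inf {C. cohen_const p U f C}"

end

theory Submission
  imports Defs "HOL-Complex_Analysis.Cauchy_Integral_Formula"
begin

text \<open>
  Everything follows from one equivalence: a number \<open>C\<close> is a Cohen constant of a bounded holomorphic mapping \<open>f\<close> if
  and only if it is a strong summability constant of its linearization \<open>T\<close>. Equality of the two norms
  is then equality of two infima over the same set.

  The vectors \<open>l *\<^sub>C evaluation U x\<close> have norm at most \<open>\<bar>l\<bar>\<close>, so the inequality for operators specialises to the
  one for mappings (\<open>strongly_summing_const_imp_cohen_const\<close>). The converse rests on the
  geometry of the predual: its unit ball is the closed absolutely convex hull of the
  evaluations (\<open>atomic_approximation\<close>), so an element \<open>\<phi>\<close> is, up to a small error, a combination of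
  evaluations whose coefficients add up in absolute value to little more than its norm. Splitting every entry of a
  sequence in this way, and dividing each coefficient between the scalars and the functionals in the
  ratio of the exponents \<open>1 / p\<close> and \<open>1 / q\<close>, where \<open>1 / p + 1 / q = 1\<close>, increases neither the \<open>\<ell>\<^sub>p\<close> norm
  of the scalars nor the weak \<open>\<ell>\<^sub>q\<close> norm of the functionals (\<open>lp_set_split\<close>). The inequality for mappings applied to
  the finer sequence is the inequality for operators, with the same constant
  (\<open>cohen_const_imp_strongly_summing_const\<close>).

  The description of the unit ball is a separation argument. A functional that separates \<open>\<phi>\<close> from the hull is
  bounded on the predual, and its values on the evaluations form a function in the unit
  ball of the bounded holomorphic functions; the pairing of \<open>\<phi>\<close> with this function shows that \<open>\<phi>\<close> has norm
  greater than one. The holomorphy of this function, as well as the surjectivity of the correspondence, come from the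
  holomorphy of the evaluation map for the norm of the predual (\<open>G_op_evaluation_hol_bdd\<close>), a consequence
  of Cauchy's estimates on complex lines.

  The Hahn-Banach theorem for complex seminorms (\<open>complex_hahn_banach\<close>) enters in the separation argument and through
  the norming functionals of the target space. These make the linearization take its values in that space rather than in its bidual,
  and they show that Cohen strongly summing mappings are bounded and that the Cohen norm is definite.
\<close>

section \<open>The Hahn-Banach theorem for complex seminorms\<close>

definition sublinear_on :: "'v::complex_vector set \<Rightarrow> ('v \<Rightarrow> real) \<Rightarrow> bool" where
  "sublinear_on V m \<longleftrightarrow>
    (\<forall>x\<in>V. \<forall>y\<in>V. m (x + y) \<le> m x + m y) \<and>
    (\<forall>t\<ge>0. \<forall>x\<in>V. m (complex_of_real t *\<^sub>C x) = t * m x)"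

lemma sublinear_onI:
  assumes V: "complex_vector.subspace V"
    and add: "\<And>x y. x \<in> V \<Longrightarrow> y \<in> V \<Longrightarrow> m (x + y) \<le> m x + m y"
    and zero: "m 0 = 0"
    and scale: "\<And>t x. 0 < t \<Longrightarrow> x \<in> V \<Longrightarrow> m (complex_of_real t *\<^sub>C x) \<le> t * m x"
  shows "sublinear_on V m"
  unfolding sublinear_on_def
proof (intro conjI ballI allI impI)
  fix t :: real and x assume t: "0 \<le> t" and x: "x \<in> V"
  show "m (complex_of_real t *\<^sub>C x) = t * m x"
  proof (cases "t = 0")
    case True
    then show ?thesis by (simp add: zero)
  next
    case False
    with t have tp: "0 < t" by simp
    have tx: "complex_of_real t *\<^sub>C x \<in> V"
      using V x by (rule complex_vector.subspace_scale)
    have "m (complex_of_real (inverse t) *\<^sub>C complex_of_real t *\<^sub>C x)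
        \<le> inverse t * m (complex_of_real t *\<^sub>C x)"
      using tp tx by (intro scale) auto
    moreover have "complex_of_real (inverse t) *\<^sub>C complex_of_real t *\<^sub>C x = x"
      using False by (simp flip: of_real_mult)
    ultimately have "t * m x \<le> m (complex_of_real t *\<^sub>C x)"
      using tp by (simp add: field_simps)
    with scale[OF tp x] show ?thesis by simp
  qed
qed (use add in auto)

lemma sublinear_on_add: "sublinear_on V m \<Longrightarrow> x \<in> V \<Longrightarrow> y \<in> V \<Longrightarrow> m (x + y) \<le> m x + m y"
  by (simp add: sublinear_on_def)

lemma sublinear_on_scale:
  "sublinear_on V m \<Longrightarrow> 0 \<le> t \<Longrightarrow> x \<in> V \<Longrightarrow> m (complex_of_real t *\<^sub>C x) = t * m x"
  by (simp add: sublinear_on_def)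

lemma sublinear_on_zero:
  assumes "complex_vector.subspace V" "sublinear_on V m"
  shows "m 0 = 0"
  using sublinear_on_scale[OF assms(2), of 0 0] complex_vector.subspace_0[OF assms(1)] by simp

lemma sublinear_on_minus:
  assumes "complex_vector.subspace V" "sublinear_on V m" "x \<in> V"
  shows "- m (- x) \<le> m x"
  using sublinear_on_add[OF assms(2,3), of "- x"] sublinear_on_zero[OF assms(1,2)]
    complex_vector.subspace_neg[OF assms(1,3)] by simp

text \<open>
  Subtracting the slope of \<open>m\<close> along the ray of \<open>y\<close> and minimising gives a smaller sublinear
  functional whose value at \<open>- y\<close> is as small as linearity at \<open>y\<close> demands. Thus a minimal
  sublinear functional admits no proper tilt, which forces it to be additive.
\<close>

lemma sublinear_on_tilt:
  assumes V: "complex_vector.subspace V" and m: "sublinear_on V m" and y: "y \<in> V"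
  obtains m' where "sublinear_on V m'" "\<And>x. x \<in> V \<Longrightarrow> m' x \<le> m x"
    "\<And>x. x \<in> V \<Longrightarrow> m' x \<le> m (x + y) - m y"
proof -
  define g where "g x t = m (x + complex_of_real t *\<^sub>C y) - t * m y" for x t
  define m' where "m' x = (if x \<in> V then (INF t\<in>{0..}. g x t) else 0)" for x
  have ty: "complex_of_real t *\<^sub>C y \<in> V" for t
    using V y by (rule complex_vector.subspace_scale)
  have lower: "- m (- x) \<le> g x t" if "x \<in> V" "0 \<le> t" for x t
  proof -
    have "m (- x + (x + complex_of_real t *\<^sub>C y)) \<le> m (- x) + m (x + complex_of_real t *\<^sub>C y)"
      by (intro sublinear_on_add[OF m] complex_vector.subspace_neg complex_vector.subspace_add V ty that)
    moreover have "m (complex_of_real t *\<^sub>C y) = t * m y"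
      using m that y by (simp add: sublinear_on_scale)
    ultimately show ?thesis by (simp add: g_def)
  qed
  have bdd: "bdd_below (g x ` {0..})" if "x \<in> V" for x
    using lower[OF that] by (intro bdd_belowI2) auto
  have le: "m' x \<le> g x t" if "x \<in> V" "0 \<le> t" for x t
    using that by (auto simp: m'_def intro!: cINF_lower bdd)
  have greatest: "c \<le> m' x" if "x \<in> V" "\<And>t. 0 \<le> t \<Longrightarrow> c \<le> g x t" for c x
    using that by (auto simp: m'_def intro!: cINF_greatest)
  have "sublinear_on V m'"
  proof (rule sublinear_onI[OF V])
    fix x z assume xz: "x \<in> V" "z \<in> V"
    have xz': "x + z \<in> V" using V xz by (rule complex_vector.subspace_add)
    have *: "m' (x + z) \<le> g x t + g z s" if "0 \<le> t" "0 \<le> s" for t s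
    proof -
      have "m' (x + z) \<le> g (x + z) (t + s)"
        using that xz' by (intro le) auto
      also have "x + z + complex_of_real (t + s) *\<^sub>C y
          = (x + complex_of_real t *\<^sub>C y) + (z + complex_of_real s *\<^sub>C y)"
        by (simp add: scaleC_add_left algebra_simps)
      then have "g (x + z) (t + s) \<le> g x t + g z s"
        using sublinear_on_add[OF m, of "x + complex_of_real t *\<^sub>C y" "z + complex_of_real s *\<^sub>C y"]
          V xz ty by (simp add: g_def complex_vector.subspace_add algebra_simps)
      finally show ?thesis .
    qed
    have "m' (x + z) - g x t \<le> m' z" if "0 \<le> t" for t
      using *[OF that] xz by (intro greatest) (auto simp: algebra_simps)
    then have "m' (x + z) - m' z \<le> m' x"
      using xz by (intro greatest) (auto simp: algebra_simps)
    then show "m' (x + z) \<le> m' x + m' z" by simp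
  next
    have "g 0 t = 0" if "0 \<le> t" for t
      using sublinear_on_scale[OF m that y] by (simp add: g_def)
    then show "m' 0 = 0"
      using le[of 0 0] greatest[of 0 0] complex_vector.subspace_0[OF V] by force
  next
    fix r :: real and x assume r: "0 < r" and x: "x \<in> V"
    have rx: "complex_of_real r *\<^sub>C x \<in> V" using V x by (rule complex_vector.subspace_scale)
    have "inverse r * m' (complex_of_real r *\<^sub>C x) \<le> g x t" if t: "0 \<le> t" for t
    proof -
      have "m' (complex_of_real r *\<^sub>C x) \<le> g (complex_of_real r *\<^sub>C x) (r * t)"
        using rx r t by (intro le) auto
      also have "complex_of_real r *\<^sub>C x + complex_of_real (r * t) *\<^sub>C y
          = complex_of_real r *\<^sub>C (x + complex_of_real t *\<^sub>C y)"
        by (simp add: scaleC_add_right scaleC_scaleC)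
      then have "g (complex_of_real r *\<^sub>C x) (r * t) = r * g x t"
        using sublinear_on_scale[OF m, of r "x + complex_of_real t *\<^sub>C y"] r V x ty
        by (simp add: g_def complex_vector.subspace_add algebra_simps)
      finally show ?thesis using r by (simp add: field_simps)
    qed
    then have "inverse r * m' (complex_of_real r *\<^sub>C x) \<le> m' x"
      using x by (intro greatest)
    then show "m' (complex_of_real r *\<^sub>C x) \<le> r * m' x"
      using r by (simp add: field_simps)
  qed
  moreover have "m' x \<le> m x" if "x \<in> V" for x
    using le[OF that, of 0] by (simp add: g_def)
  moreover have "m' x \<le> m (x + y) - m y" if "x \<in> V" for x
    using le[OF that, of 1] by (simp add: g_def scaleC_one)
  ultimately show thesis
    by (rule that)
qed

text \<open>
  Zorn's lemma applies because the pointwise infimum of a chain of sublinear functionals below \<open>q\<close>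
  is finite, each of them being at least \<open>- q (- x)\<close>, and is again sublinear since two members of a chain
  can be replaced by the smaller one. The functionals are set to \<open>0\<close> outside \<open>V\<close> so that the pointwise
  order on total functions is antisymmetric.
\<close>

lemma minimal_sublinear_on:
  assumes V: "complex_vector.subspace V" and q: "sublinear_on V q"
  obtains m where "sublinear_on V m" "\<And>x. x \<in> V \<Longrightarrow> m x \<le> q x"
    "\<And>m' x. sublinear_on V m' \<Longrightarrow> (\<And>x. x \<in> V \<Longrightarrow> m' x \<le> m x) \<Longrightarrow> x \<in> V \<Longrightarrow> m' x = m x"
proof -
  define A where "A = {m. sublinear_on V m \<and> (\<forall>x\<in>V. m x \<le> q x) \<and> (\<forall>x. x \<notin> V \<longrightarrow> m x = 0)}"
  let ?P = "\<lambda>a b :: 'a \<Rightarrow> real. b \<le> a"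
  let ?cut = "\<lambda>m x. if x \<in> V then m x else (0::real)"
  have cut: "sublinear_on V (?cut m)" if "sublinear_on V m" for m
    using that V by (auto simp: sublinear_on_def complex_vector.subspace_add complex_vector.subspace_scale)
  have po: "partial_order_on A (relation_of ?P A)"
    by (rule partial_order_on_relation_ofI) (auto intro: order.trans)
  have "\<exists>m\<in>A. \<forall>a\<in>A. ?P m a \<longrightarrow> a = m"
  proof (rule predicate_Zorn[OF po])
    fix C assume C: "C \<in> Chains (relation_of ?P A)"
    then have CA: "C \<subseteq> A" by (rule Chains_relation_of)
    have total: "a \<le> b \<or> b \<le> a" if "a \<in> C" "b \<in> C" for a b
      using C that by (auto simp: Chains_def relation_of_def)
    show "\<exists>u\<in>A. \<forall>a\<in>C. u \<le> a"
    proof (cases "C = {}")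
      case True
      then show ?thesis using cut[OF q] by (intro bexI[of _ "?cut q"]) (auto simp: A_def)
    next
      case False
      define u where "u = ?cut (\<lambda>x. INF a\<in>C. a x)"
      have sub: "sublinear_on V a" if "a \<in> C" for a using that CA by (auto simp: A_def)
      have lower: "- q (- x) \<le> a x" if "a \<in> C" "x \<in> V" for a x
      proof -
        have "a (- x) \<le> q (- x)"
          using that CA complex_vector.subspace_neg[OF V that(2)] by (auto simp: A_def)
        then show ?thesis using sublinear_on_minus[OF V sub that(2), of a] that(1) by simp
      qed
      have bdd: "bdd_below ((\<lambda>a. a x) ` C)" if "x \<in> V" for x
        using lower that by (intro bdd_belowI2) auto
      have le: "u x \<le> a x" if "a \<in> C" "x \<in> V" for a x
        using that by (auto simp: u_def intro!: cINF_lower bdd)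
      have greatest: "c \<le> u x" if "x \<in> V" "\<And>a. a \<in> C \<Longrightarrow> c \<le> a x" for c x
        using that False by (auto simp: u_def intro!: cINF_greatest)
      have "sublinear_on V u"
      proof (rule sublinear_onI[OF V])
        fix x z assume xz: "x \<in> V" "z \<in> V"
        have xz': "x + z \<in> V" using V xz by (rule complex_vector.subspace_add)
        have *: "u (x + z) \<le> a x + b z" if ab: "a \<in> C" "b \<in> C" for a b
        proof -
          obtain c where c: "c \<in> C" "c \<le> a" "c \<le> b" using total[OF ab] ab by blast
          have "u (x + z) \<le> c (x + z)" using c xz' by (intro le)
          also have "\<dots> \<le> c x + c z" using sub[OF c(1)] xz by (rule sublinear_on_add)
          also have "\<dots> \<le> a x + b z" using c by (intro add_mono) (auto simp: le_fun_def)
          finally show ?thesis .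
        qed
        have "u (x + z) - a x \<le> u z" if "a \<in> C" for a
          using *[OF that] xz by (intro greatest) (auto simp: algebra_simps)
        then have "u (x + z) - u z \<le> u x"
          using xz by (intro greatest) (auto simp: algebra_simps)
        then show "u (x + z) \<le> u x + u z" by simp
      next
        have "a 0 = 0" if "a \<in> C" for a using sublinear_on_zero[OF V sub[OF that]] .
        moreover obtain a where "a \<in> C" using False by blast
        ultimately show "u 0 = 0"
          using le[of a 0] greatest[of 0 0] complex_vector.subspace_0[OF V] by force
      next
        fix r :: real and x assume r: "0 < r" and x: "x \<in> V"
        have rx: "complex_of_real r *\<^sub>C x \<in> V" using V x by (rule complex_vector.subspace_scale)
        have "inverse r * u (complex_of_real r *\<^sub>C x) \<le> a x" if "a \<in> C" for a
          using le[OF that rx] sublinear_on_scale[OF sub[OF that] _ x, of r] r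
          by (simp add: field_simps)
        then have "inverse r * u (complex_of_real r *\<^sub>C x) \<le> u x"
          using x by (intro greatest)
        then show "u (complex_of_real r *\<^sub>C x) \<le> r * u x"
          using r by (simp add: field_simps)
      qed
      moreover have "u x \<le> q x" if "x \<in> V" for x
      proof -
        obtain a where "a \<in> C" using False by blast
        then show ?thesis using le[of a x] that CA by (force simp: A_def)
      qed
      moreover have "u \<le> a" if "a \<in> C" for a
        using le[OF that] that CA by (auto simp: le_fun_def A_def u_def)
      ultimately show ?thesis by (intro bexI[of _ u]) (auto simp: A_def u_def)
    qed
  qed
  then obtain m where m: "m \<in> A" and min: "\<And>a. a \<in> A \<Longrightarrow> a \<le> m \<Longrightarrow> a = m" by blast
  show thesis
  proof (rule that[of m])
    fix m' x assume m': "sublinear_on V m'" "\<And>x. x \<in> V \<Longrightarrow> m' x \<le> m x" and x: "x \<in> V"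
    have "?cut m' = m"
      using m cut[OF m'(1)] m'(2) by (intro min) (force simp: A_def le_fun_def)+
    then show "m' x = m x" using x by (auto dest: fun_cong[of _ _ x])
  qed (use m in \<open>auto simp: A_def\<close>)
qed

text \<open>
  Tilting \<open>q\<close> along \<open>x0\<close> before minimising pins the value at \<open>- x0\<close> below \<open>- q x0\<close>; a minimal
  functional below this tilt is linear and therefore takes the value \<open>q x0\<close> at \<open>x0\<close>.
\<close>

lemma real_hahn_banach:
  assumes V: "complex_vector.subspace V" and q: "sublinear_on V q" and x0: "x0 \<in> V"
  obtains u where "\<And>x y. x \<in> V \<Longrightarrow> y \<in> V \<Longrightarrow> u (x + y) = u x + u y"
    "\<And>t x. x \<in> V \<Longrightarrow> u (complex_of_real t *\<^sub>C x) = t * u x"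
    "\<And>x. x \<in> V \<Longrightarrow> u x \<le> q x" "u x0 = q x0"
proof -
  obtain q' where q': "sublinear_on V q'" "\<And>x. x \<in> V \<Longrightarrow> q' x \<le> q x"
    "\<And>x. x \<in> V \<Longrightarrow> q' x \<le> q (x + x0) - q x0"
    by (rule sublinear_on_tilt[OF V q x0]) blast
  obtain m where m: "sublinear_on V m" "\<And>x. x \<in> V \<Longrightarrow> m x \<le> q' x"
    and min: "\<And>m' x. sublinear_on V m' \<Longrightarrow> (\<And>x. x \<in> V \<Longrightarrow> m' x \<le> m x) \<Longrightarrow> x \<in> V \<Longrightarrow> m' x = m x"
    by (rule minimal_sublinear_on[OF V q'(1)]) blast
  have add: "m (x + y) = m x + m y" if x: "x \<in> V" and y: "y \<in> V" for x y
  proof -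
    obtain m' where m': "sublinear_on V m'" "\<And>x. x \<in> V \<Longrightarrow> m' x \<le> m x"
      "\<And>x. x \<in> V \<Longrightarrow> m' x \<le> m (x + y) - m y"
      by (rule sublinear_on_tilt[OF V m(1) y]) blast
    have "m' x = m x" using m'(1,2) x by (rule min)
    with m'(3)[OF x] have "m x \<le> m (x + y) - m y" by simp
    with sublinear_on_add[OF m(1) x y] show ?thesis by simp
  qed
  have neg: "m (- x) = - m x" if "x \<in> V" for x
    using add[OF that complex_vector.subspace_neg[OF V that]] sublinear_on_zero[OF V m(1)] by simp
  have scale: "m (complex_of_real t *\<^sub>C x) = t * m x" if x: "x \<in> V" for t x
  proof (cases "0 \<le> t")
    case True
    then show ?thesis using m(1) x by (simp add: sublinear_on_scale)
  next
    case False
    then have "m (complex_of_real (- t) *\<^sub>C x) = - t * m x"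
      using m(1) x by (intro sublinear_on_scale) auto
    moreover have "complex_of_real (- t) *\<^sub>C x = - (complex_of_real t *\<^sub>C x)" by simp
    ultimately show ?thesis
      using neg[OF complex_vector.subspace_scale[OF V x, of "complex_of_real t"]] by simp
  qed
  have "m (- x0) \<le> - q x0"
    using m(2)[of "- x0"] q'(3)[of "- x0"] complex_vector.subspace_neg[OF V x0]
      sublinear_on_zero[OF V q] by simp
  then have eq: "m x0 = q x0"
    using neg[OF x0] m(2)[OF x0] q'(2)[OF x0] by simp
  have le: "m x \<le> q x" if "x \<in> V" for x
    using m(2)[OF that] q'(2)[OF that] by simp
  show thesis
    by (rule that[of m]) (use add scale le eq in auto)
qed

text \<open>
  A real functional \<open>u\<close> is the real part of the complex functional \<open>u x - i u (i x)\<close>. Rotating the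
  argument so that the value becomes real carries the bound over from \<open>u\<close>; at \<open>x0\<close> the bound leaves
  no room for an imaginary part.
\<close>

theorem complex_hahn_banach:
  assumes V: "complex_vector.subspace V"
    and q_add: "\<And>x y. x \<in> V \<Longrightarrow> y \<in> V \<Longrightarrow> q (x + y) \<le> q x + q y"
    and q_scale: "\<And>a x. x \<in> V \<Longrightarrow> q (a *\<^sub>C x) = cmod a * q x"
    and x0: "x0 \<in> V"
  obtains L where "clinear_on V L" "\<And>x. x \<in> V \<Longrightarrow> cmod (L x) \<le> q x" "L x0 = complex_of_real (q x0)"
proof -
  have "sublinear_on V q"
    using q_add q_scale by (auto simp: sublinear_on_def)
  from V this x0 obtain u where u_add: "\<And>x y. x \<in> V \<Longrightarrow> y \<in> V \<Longrightarrow> u (x + y) = u x + u y"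
    and u_scale: "\<And>t x. x \<in> V \<Longrightarrow> u (complex_of_real t *\<^sub>C x) = t * u x"
    and u_le: "\<And>x. x \<in> V \<Longrightarrow> u x \<le> q x" and u_x0: "u x0 = q x0"
    by (rule real_hahn_banach) blast
  define L where "L x = Complex (u x) (- u (\<i> *\<^sub>C x))" for x
  have scV: "a *\<^sub>C x \<in> V" if "x \<in> V" for a x using V that by (rule complex_vector.subspace_scale)
  have L_scale: "L (a *\<^sub>C x) = a * L x" if x: "x \<in> V" for a x
  proof -
    have split: "u (b *\<^sub>C x) = Re b * u x + Im b * u (\<i> *\<^sub>C x)" for b
    proof -
      have "b *\<^sub>C x = complex_of_real (Re b) *\<^sub>C x + complex_of_real (Im b) *\<^sub>C \<i> *\<^sub>C x"
        by (subst complex_eq[of b]) (simp add: scaleC_add_left scaleC_scaleC mult.commute)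
      then show ?thesis
        using x scV by (simp add: u_add u_scale del: complex_vector.scale_scale)
    qed
    show ?thesis
      by (simp add: L_def complex_eq_iff scaleC_scaleC split[of a] split[of "\<i> * a"])
  qed
  have "clinear_on V L"
    unfolding clinear_on_def
  proof (intro conjI ballI allI)
    fix x y assume "x \<in> V" "y \<in> V"
    then show "L (x + y) = L x + L y" using scV by (simp add: L_def u_add scaleC_add_right complex_eq_iff)
  qed (simp add: L_scale scaleC_complex_def)
  moreover have bound: "cmod (L x) \<le> q x" if x: "x \<in> V" for x
  proof (cases "L x = 0")
    case True
    have "0 = q (0 *\<^sub>C x)" using q_scale[OF x, of 0] by simp
    also have "\<dots> \<le> q x + q ((- 1) *\<^sub>C x)" 
      using q_add[OF x scV[OF x, of "- 1"]] q_scale[OF x, of 0] by simp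
    also have "\<dots> = 2 * q x" using q_scale[OF x, of "- 1"] by simp
    finally show ?thesis using True by simp
  next
    case False
    define a where "a = cnj (L x) / complex_of_real (cmod (L x))"
    have a: "cmod a = 1" using False by (simp add: a_def norm_divide)
    have "L (a *\<^sub>C x) = complex_of_real (cmod (L x))"
      using False by (simp add: L_scale[OF x] a_def complex_norm_square[symmetric] mult.commute power2_eq_square)
    then have "cmod (L x) = u (a *\<^sub>C x)" by (simp add: L_def complex_eq_iff)
    also have "\<dots> \<le> q x" using u_le[OF scV[OF x, of a]] q_scale[OF x, of a] a by simp
    finally show ?thesis .
  qed
  moreover have "L x0 = complex_of_real (q x0)"
  proof -
    have "(cmod (L x0))\<^sup>2 \<le> (q x0)\<^sup>2" using bound[OF x0] by (intro power_mono) auto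
    then have "Im (L x0) = 0" by (simp add: cmod_power2 L_def u_x0)
    then show ?thesis by (simp add: complex_eq_iff L_def u_x0)
  qed
  ultimately show thesis by (rule that)
qed

section \<open>Operator norms on carriers\<close>

lemma normed_space_on_subspace: "normed_space_on V N \<Longrightarrow> complex_vector.subspace V"
  by (simp add: normed_space_on_def)

lemma normed_space_on_nonneg: "normed_space_on V N \<Longrightarrow> x \<in> V \<Longrightarrow> 0 \<le> N x"
  by (simp add: normed_space_on_def)

lemma normed_space_on_eq_0_iff: "normed_space_on V N \<Longrightarrow> x \<in> V \<Longrightarrow> N x = 0 \<longleftrightarrow> x = 0"
  by (simp add: normed_space_on_def)

lemma normed_space_on_triangle:
  "normed_space_on V N \<Longrightarrow> x \<in> V \<Longrightarrow> y \<in> V \<Longrightarrow> N (x + y) \<le> N x + N y"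
  by (simp add: normed_space_on_def)

lemma normed_space_on_scale:
  "normed_space_on V N \<Longrightarrow> x \<in> V \<Longrightarrow> N (a *\<^sub>C x) = cmod a * N x"
  by (simp add: normed_space_on_def)

lemma normed_space_on_zero: "normed_space_on V N \<Longrightarrow> N 0 = 0"
  by (simp add: normed_space_on_eq_0_iff complex_vector.subspace_0[OF normed_space_on_subspace])

lemma normed_space_on_triangle_diff:
  assumes "normed_space_on V N" "x \<in> V" "y \<in> V"
  shows "N (x - y) \<le> N x + N y"
  using normed_space_on_triangle[OF assms(1,2), of "(- 1) *\<^sub>C y"]
    normed_space_on_scale[OF assms(1,3), of "- 1"]
    complex_vector.subspace_scale[OF normed_space_on_subspace[OF assms(1)] assms(3), of "- 1"]
  by simp

lemma normed_space_on_subset: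
  assumes "normed_space_on V N" "complex_vector.subspace W" "W \<subseteq> V"
  shows "normed_space_on W N"
  using assms by (auto simp: normed_space_on_def subset_iff)

lemma normed_space_on_UNIV: "normed_space_on UNIV (norm :: 'a::complex_normed_vector \<Rightarrow> real)"
  by (auto simp: normed_space_on_def norm_scaleC norm_triangle_ineq intro: complex_vector.subspace_UNIV)

lemma clinear_on_subset: "clinear_on V T \<Longrightarrow> W \<subseteq> V \<Longrightarrow> clinear_on W T"
  unfolding clinear_on_def by blast

lemma clinear_on_add: "clinear_on V T \<Longrightarrow> x \<in> V \<Longrightarrow> y \<in> V \<Longrightarrow> T (x + y) = T x + T y"
  by (simp add: clinear_on_def)

lemma clinear_on_scale: "clinear_on V T \<Longrightarrow> x \<in> V \<Longrightarrow> T (a *\<^sub>C x) = a *\<^sub>C T x"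
  by (simp add: clinear_on_def)

lemma clinear_on_zero: "clinear_on V T \<Longrightarrow> complex_vector.subspace V \<Longrightarrow> T 0 = 0"
  using clinear_on_scale[of V T 0 0] complex_vector.subspace_0[of V] by simp

lemma clinear_on_diff:
  assumes "clinear_on V T" "complex_vector.subspace V" "x \<in> V" "y \<in> V"
  shows "T (x - y) = T x - T y"
  using clinear_on_add[OF assms(1,3), of "(- 1) *\<^sub>C y"] clinear_on_scale[OF assms(1,4), of "- 1"]
    complex_vector.subspace_scale[OF assms(2,4), of "- 1"] by simp

lemma clinear_on_sum:
  assumes "clinear_on V T" "complex_vector.subspace V" "\<And>i. i \<in> I \<Longrightarrow> g i \<in> V"
  shows "T (\<Sum>i\<in>I. g i) = (\<Sum>i\<in>I. T (g i))"
  using assms(3)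
proof (induction I rule: infinite_finite_induct)
  case (insert i I)
  then show ?case
    by (simp add: clinear_on_add[OF assms(1)] complex_vector.subspace_sum[OF assms(2)])
qed (simp_all add: clinear_on_zero[OF assms(1,2)])

lemma bounded_opsI:
  assumes "clinear_on V T" "\<And>x. x \<in> V \<Longrightarrow> norm (T x) \<le> K * N x" "\<And>x. x \<notin> V \<Longrightarrow> T x = 0"
  shows "T \<in> bounded_ops V N"
  using assms by (auto simp: bounded_ops_def)

lemma bounded_ops_clinear: "T \<in> bounded_ops V N \<Longrightarrow> clinear_on V T"
  by (simp add: bounded_ops_def)

lemma bounded_ops_outside: "T \<in> bounded_ops V N \<Longrightarrow> x \<notin> V \<Longrightarrow> T x = 0"
  by (simp add: bounded_ops_def)

text \<open>
  The supremum defining the operator norm carries information only once it is known to be taken over a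
  bounded set; boundedness of \<open>T\<close> provides this.
\<close>

lemma op_norm_upper:
  assumes V: "normed_space_on V N" and T: "T \<in> bounded_ops V N" and x: "x \<in> V" "N x \<le> 1"
  shows "norm (T x) \<le> op_norm V N T"
proof -
  obtain K where K: "\<And>x. x \<in> V \<Longrightarrow> norm (T x) \<le> K * N x" using T by (auto simp: bounded_ops_def)
  have "norm (T z) \<le> \<bar>K\<bar>" if z: "z \<in> V" "N z \<le> 1" for z
  proof -
    have "norm (T z) \<le> \<bar>K\<bar> * N z"
      using K[OF z(1)] normed_space_on_nonneg[OF V z(1)]
      by (meson abs_ge_self mult_right_mono order_trans)
    also have "\<dots> \<le> \<bar>K\<bar> * 1" using z by (intro mult_left_mono) auto
    finally show ?thesis by simp
  qed
  then show ?thesis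
    unfolding op_norm_def using x by (intro cSup_upper bdd_aboveI2) auto
qed

lemma op_norm_nonneg:
  assumes "normed_space_on V N" "T \<in> bounded_ops V N"
  shows "0 \<le> op_norm V N T"
  using op_norm_upper[OF assms, of 0] complex_vector.subspace_0[OF normed_space_on_subspace[OF assms(1)]]
    normed_space_on_zero[OF assms(1)] norm_ge_zero[of "T 0"] by linarith

lemma op_norm_bound:
  assumes V: "normed_space_on V N" and T: "T \<in> bounded_ops V N" and x: "x \<in> V"
  shows "norm (T x) \<le> op_norm V N T * N x"
proof (cases "N x = 0")
  case True
  then have "x = 0" using normed_space_on_eq_0_iff[OF V x] by simp
  then show ?thesis
    using True clinear_on_zero[OF bounded_ops_clinear[OF T] normed_space_on_subspace[OF V]] by simp
next
  case False
  with normed_space_on_nonneg[OF V x] have pos: "0 < N x" by simp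
  define c where "c = complex_of_real (inverse (N x))"
  have c: "cmod c = inverse (N x)" using pos by (simp add: c_def norm_inverse)
  have "norm (T (c *\<^sub>C x)) \<le> op_norm V N T"
    using pos c by (intro op_norm_upper[OF V T] complex_vector.subspace_scale[OF normed_space_on_subspace[OF V] x])
      (simp add: normed_space_on_scale[OF V x])
  then show ?thesis
    using pos c by (simp add: clinear_on_scale[OF bounded_ops_clinear[OF T] x] norm_scaleC field_simps)
qed

lemma op_norm_le:
  assumes V: "normed_space_on V N" and "0 \<le> K" "\<And>x. x \<in> V \<Longrightarrow> norm (T x) \<le> K * N x"
  shows "op_norm V N T \<le> K"
  unfolding op_norm_def
proof (rule cSup_least)
  have "0 \<in> {x \<in> V. N x \<le> 1}"
    using complex_vector.subspace_0[OF normed_space_on_subspace[OF V]] normed_space_on_zero[OF V] by simp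
  then show "(\<lambda>x. norm (T x)) ` {x \<in> V. N x \<le> 1} \<noteq> {}" by blast
next
  fix r assume "r \<in> (\<lambda>x. norm (T x)) ` {x \<in> V. N x \<le> 1}"
  then obtain x where x: "x \<in> V" "N x \<le> 1" "r = norm (T x)" by blast
  have "norm (T x) \<le> K * N x" using assms(3) x by simp
  also have "\<dots> \<le> K * 1" using x assms(2) by (intro mult_left_mono)
  finally show "r \<le> K" using x by simp
qed

lemma normed_space_on_bounded_ops:
  assumes V: "normed_space_on V N"
  shows "normed_space_on (bounded_ops V N :: ('a::complex_vector \<Rightarrow> 'b::complex_normed_vector) set) (op_norm V N)"
proof -
  let ?B = "bounded_ops V N :: ('a \<Rightarrow> 'b) set" and ?n = "op_norm V N :: ('a \<Rightarrow> 'b) \<Rightarrow> real"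
  have add: "S + T \<in> ?B \<and> ?n (S + T) \<le> ?n S + ?n T" if S: "S \<in> ?B" and T: "T \<in> ?B" for S T
  proof -
    have *: "norm ((S + T) x) \<le> (?n S + ?n T) * N x" if "x \<in> V" for x
      using norm_triangle_ineq[of "S x" "T x"] op_norm_bound[OF V S that] op_norm_bound[OF V T that]
      by (simp add: algebra_simps)
    have "clinear_on V (S + T)"
      using bounded_ops_clinear[OF S] bounded_ops_clinear[OF T]
      by (simp add: clinear_on_def scaleC_add_right algebra_simps)
    with * show ?thesis
      using op_norm_nonneg[OF V S] op_norm_nonneg[OF V T] bounded_ops_outside[OF S] bounded_ops_outside[OF T]
      by (intro conjI op_norm_le[OF V] bounded_opsI[where K = "?n S + ?n T"]) auto
  qed
  have scale: "a *\<^sub>C T \<in> ?B \<and> ?n (a *\<^sub>C T) \<le> cmod a * ?n T" if T: "T \<in> ?B" for a T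
  proof -
    have *: "norm ((a *\<^sub>C T) x) \<le> (cmod a * ?n T) * N x" if "x \<in> V" for x
      using mult_left_mono[OF op_norm_bound[OF V T that], of "cmod a"]
      by (simp add: scaleC_fun_def norm_scaleC algebra_simps)
    have "clinear_on V (a *\<^sub>C T)"
      using bounded_ops_clinear[OF T]
      by (simp add: clinear_on_def scaleC_add_right scaleC_scaleC scaleC_fun_def mult.commute)
    with * show ?thesis
      using op_norm_nonneg[OF V T] bounded_ops_outside[OF T]
      by (intro conjI op_norm_le[OF V] bounded_opsI[where K = "cmod a * ?n T"]) (auto simp: scaleC_fun_def)
  qed
  have scale_eq: "?n (a *\<^sub>C T) = cmod a * ?n T" if T: "T \<in> ?B" for a T
  proof (cases "a = 0")
    case True
    then show ?thesis using scale[OF T, of 0] op_norm_nonneg[OF V, of "0 *\<^sub>C T"] by fastforce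
  next
    case False
    have "?n (inverse a *\<^sub>C a *\<^sub>C T) \<le> cmod (inverse a) * ?n (a *\<^sub>C T)"
      using scale[OF conjunct1[OF scale[OF T]]] by blast
    then have "cmod a * ?n T \<le> ?n (a *\<^sub>C T)"
      using False by (simp add: norm_inverse norm_divide field_simps)
    with scale[OF T, of a] show ?thesis by force
  qed
  have zero: "0 \<in> ?B" by (rule bounded_opsI[where K = 0]) (auto simp: clinear_on_def)
  have eq0: "?n T = 0 \<longleftrightarrow> T = 0" if T: "T \<in> ?B" for T
  proof
    assume "?n T = 0"
    then have "T x = 0" for x
      using op_norm_bound[OF V T, of x] bounded_ops_outside[OF T, of x] by (cases "x \<in> V") auto
    then show "T = 0" by (simp add: fun_eq_iff)
  next
    assume "T = 0"
    then show "?n T = 0" using scale_eq[OF zero, of 0] by simp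
  qed
  show ?thesis
    unfolding normed_space_on_def complex_vector.subspace_def
    using zero add scale scale_eq eq0 op_norm_nonneg[OF V] by auto
qed

lemmas normed_space_on_dual = normed_space_on_bounded_ops[where 'b = complex, folded dual_def dual_norm_def]
lemmas dual_norm_bound = op_norm_bound[where 'b = complex, folded dual_def dual_norm_def]
lemmas dual_norm_le = op_norm_le[where 'b = complex, folded dual_norm_def]
lemmas dual_norm_nonneg = op_norm_nonneg[where 'b = complex, folded dual_def dual_norm_def]
lemmas dual_clinear = bounded_ops_clinear[where 'b = complex, folded dual_def]
lemmas dualI = bounded_opsI[where 'b = complex, folded dual_def]

abbreviation dualF :: "('f::complex_normed_vector \<Rightarrow> complex) set" where
  "dualF \<equiv> dual UNIV norm"

abbreviation dualF_norm :: "('f::complex_normed_vector \<Rightarrow> complex) \<Rightarrow> real" where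
  "dualF_norm \<equiv> dual_norm UNIV norm"

lemma cmod_dual_le: "y \<in> dualF \<Longrightarrow> cmod (y z) \<le> dualF_norm y * norm z"
  by (rule dual_norm_bound[OF normed_space_on_UNIV]) auto

lemma dual_add: "y \<in> dualF \<Longrightarrow> y (a + b) = y a + y b"
  using clinear_on_add[OF dual_clinear[of y UNIV norm]] by simp

lemma dual_scale: "y \<in> dualF \<Longrightarrow> y (a *\<^sub>C z) = a * y z"
  using clinear_on_scale[OF dual_clinear[of y UNIV norm]] by (simp add: scaleC_complex_def)

lemma dual_zero: "y \<in> dualF \<Longrightarrow> y 0 = 0"
  using dual_scale[of y 0 0] by simp

lemma dual_diff: "y \<in> dualF \<Longrightarrow> y (a - b) = y a - y b"
  using clinear_on_diff[OF dual_clinear[of y UNIV norm] complex_vector.subspace_UNIV] by simp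

lemma dual_sum: "y \<in> dualF \<Longrightarrow> y (\<Sum>i\<in>I. g i) = (\<Sum>i\<in>I. y (g i))"
  using clinear_on_sum[OF dual_clinear[of y UNIV norm] complex_vector.subspace_UNIV] by simp

lemma bounded_linear_clinear:
  fixes T :: "'a::complex_normed_vector \<Rightarrow> 'b::complex_normed_vector"
  assumes "clinear_on UNIV T" "\<And>x. norm (T x) \<le> K * norm x"
  shows "bounded_linear T"
  by (rule bounded_linear_intro[where K = K])
     (use assms in \<open>auto simp: clinear_on_def scaleR_eq_scaleC mult.commute\<close>)

lemma bounded_linear_dual: "y \<in> dualF \<Longrightarrow> bounded_linear y"
  by (rule bounded_linear_clinear[OF dual_clinear cmod_dual_le])

text \<open>
  The Hahn-Banach theorem with the norm itself as dominating seminorm.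
\<close>

lemma norming_functional:
  fixes z :: "'f::complex_normed_vector"
  obtains y where "y \<in> dualF" "dualF_norm y \<le> 1" "y z = complex_of_real (norm z)"
proof -
  obtain y where y: "clinear_on UNIV y" "\<And>x. cmod (y x) \<le> norm x" "y z = complex_of_real (norm z)"
    by (rule complex_hahn_banach[OF complex_vector.subspace_UNIV, of norm z])
      (auto simp: norm_triangle_ineq norm_scaleC)
  show thesis
    using y by (intro that[of y] dualI[where K = 1] dual_norm_le[OF normed_space_on_UNIV]) auto
qed

lemma dual_separates:
  assumes "\<And>y. y \<in> dualF \<Longrightarrow> y a = y b"
  shows "a = (b :: 'f::complex_normed_vector)"
proof -
  obtain y where y: "y \<in> dualF" "y (a - b) = complex_of_real (norm (a - b))"
    by (rule norming_functional)
  with assms[OF y(1)] show ?thesis by (simp add: dual_diff)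
qed

section \<open>Bounded holomorphic mappings\<close>

lemma bounded_linear_scaleC: "bounded_linear (\<lambda>z :: 'a::complex_normed_vector. a *\<^sub>C z)"
  by (rule bounded_linear_clinear[where K = "cmod a"])
    (simp_all add: clinear_on_def scaleC_add_right mult.commute norm_scaleC)

lemma hol_outside: "f \<in> hol U \<Longrightarrow> x \<notin> U \<Longrightarrow> f x = 0"
  by (simp add: hol_def)

lemma hol_derivative:
  assumes "f \<in> hol U" "x \<in> U"
  obtains A where "clinear_on UNIV A" "(f has_derivative A) (at x)"
  using assms by (auto simp: hol_def)

lemma subspace_hol: "complex_vector.subspace (hol U :: ('e::complex_banach \<Rightarrow> 'f::complex_banach) set)"
  unfolding complex_vector.subspace_def
proof (intro conjI ballI allI)
  show "0 \<in> (hol U :: ('e \<Rightarrow> 'f) set)"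
    by (auto simp: hol_def zero_fun_def clinear_on_def intro!: exI[of _ "\<lambda>_. 0"] derivative_intros)
next
  fix f g :: "'e \<Rightarrow> 'f" assume f: "f \<in> hol U" and g: "g \<in> hol U"
  have "\<exists>A. clinear_on UNIV A \<and> ((f + g) has_derivative A) (at x)" if x: "x \<in> U" for x
  proof -
    obtain A where A: "clinear_on UNIV A" "(f has_derivative A) (at x)" using f x by (rule hol_derivative)
    obtain B where B: "clinear_on UNIV B" "(g has_derivative B) (at x)" using g x by (rule hol_derivative)
    have "clinear_on UNIV (\<lambda>v. A v + B v)"
      using A(1) B(1) by (simp add: clinear_on_def scaleC_add_right algebra_simps)
    moreover have "((f + g) has_derivative (\<lambda>v. A v + B v)) (at x)"
      unfolding plus_fun_def using A(2) B(2) by (rule has_derivative_add)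
    ultimately show ?thesis by blast
  qed
  then show "f + g \<in> hol U" using hol_outside[OF f] hol_outside[OF g] by (auto simp: hol_def)
next
  fix a and f :: "'e \<Rightarrow> 'f" assume f: "f \<in> hol U"
  have "\<exists>A. clinear_on UNIV A \<and> ((a *\<^sub>C f) has_derivative A) (at x)" if x: "x \<in> U" for x
  proof -
    obtain A where A: "clinear_on UNIV A" "(f has_derivative A) (at x)" using f x by (rule hol_derivative)
    have "clinear_on UNIV (\<lambda>v. a *\<^sub>C A v)"
      using A(1) by (simp add: clinear_on_def scaleC_add_right mult.commute)
    moreover have "((a *\<^sub>C f) has_derivative (\<lambda>v. a *\<^sub>C A v)) (at x)"
      unfolding scaleC_fun_def using bounded_linear_scaleC A(2) by (rule bounded_linear.has_derivative)
    ultimately show ?thesis by blast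
  qed
  then show "a *\<^sub>C f \<in> hol U" using hol_outside[OF f] by (auto simp: hol_def scaleC_fun_def)
qed

lemma hol_bddI:
  assumes "f \<in> hol U" "\<And>x. x \<in> U \<Longrightarrow> norm (f x) \<le> K"
  shows "f \<in> hol_bdd U"
  using assms by (auto simp: hol_bdd_def intro: boundedI)

lemma hol_bdd_imp_hol: "f \<in> hol_bdd U \<Longrightarrow> f \<in> hol U"
  by (simp add: hol_bdd_def)

lemma norm_le_sup_norm:
  assumes "f \<in> hol_bdd U" "x \<in> U"
  shows "norm (f x) \<le> sup_norm U f"
proof -
  have "bdd_above ((\<lambda>x. norm (f x)) ` U)"
    using assms(1) by (auto simp: hol_bdd_def bounded_iff bdd_above_def)
  then show ?thesis
    unfolding sup_norm_def using assms(2) by (intro cSup_upper) auto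
qed

lemma sup_norm_nonneg:
  assumes "f \<in> hol_bdd U"
  shows "0 \<le> sup_norm U f"
proof -
  have "bdd_above ((\<lambda>x. norm (f x)) ` U)"
    using assms by (auto simp: hol_bdd_def bounded_iff bdd_above_def)
  then show ?thesis
    unfolding sup_norm_def by (intro cSup_upper) auto
qed

lemma sup_norm_le: "0 \<le> K \<Longrightarrow> (\<And>x. x \<in> U \<Longrightarrow> norm (f x) \<le> K) \<Longrightarrow> sup_norm U f \<le> K"
  unfolding sup_norm_def by (rule cSup_least) auto

lemma normed_space_on_hol_bdd:
  "normed_space_on (hol_bdd U :: ('e::complex_banach \<Rightarrow> 'f::complex_banach) set) (sup_norm U)"
proof -
  let ?H = "hol_bdd U :: ('e \<Rightarrow> 'f) set"
  have zero: "0 \<in> ?H"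
    by (rule hol_bddI[where K = 0]) (auto simp: complex_vector.subspace_0[OF subspace_hol])
  have add: "f + g \<in> ?H \<and> sup_norm U (f + g) \<le> sup_norm U f + sup_norm U g"
    if f: "f \<in> ?H" and g: "g \<in> ?H" for f g
  proof -
    have "norm ((f + g) x) \<le> sup_norm U f + sup_norm U g" if "x \<in> U" for x
      using norm_le_sup_norm[OF f that] norm_le_sup_norm[OF g that] norm_triangle_ineq[of "f x" "g x"] by simp
    then show ?thesis
      using f g sup_norm_nonneg[OF f] sup_norm_nonneg[OF g]
      by (intro conjI hol_bddI[where K = "sup_norm U f + sup_norm U g"] sup_norm_le
          complex_vector.subspace_add[OF subspace_hol]) (auto intro: hol_bdd_imp_hol)
  qed
  have scale: "a *\<^sub>C f \<in> ?H \<and> sup_norm U (a *\<^sub>C f) \<le> cmod a * sup_norm U f" if f: "f \<in> ?H" for a f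
  proof -
    have "norm ((a *\<^sub>C f) x) \<le> cmod a * sup_norm U f" if "x \<in> U" for x
      using norm_le_sup_norm[OF f that] by (simp add: scaleC_fun_def norm_scaleC mult_left_mono)
    then show ?thesis
      using f sup_norm_nonneg[OF f]
      by (intro conjI hol_bddI[where K = "cmod a * sup_norm U f"] sup_norm_le
          complex_vector.subspace_scale[OF subspace_hol]) (auto intro: hol_bdd_imp_hol)
  qed
  have scale_eq: "sup_norm U (a *\<^sub>C f) = cmod a * sup_norm U f" if f: "f \<in> ?H" for a f
  proof (cases "a = 0")
    case True
    then show ?thesis using scale[OF f, of 0] sup_norm_nonneg[of "0 *\<^sub>C f" U] by fastforce
  next
    case False
    have "sup_norm U (inverse a *\<^sub>C a *\<^sub>C f) \<le> cmod (inverse a) * sup_norm U (a *\<^sub>C f)"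
      using scale[OF conjunct1[OF scale[OF f]]] by blast
    then have "cmod a * sup_norm U f \<le> sup_norm U (a *\<^sub>C f)"
      using False by (simp add: norm_inverse norm_divide field_simps)
    with scale[OF f, of a] show ?thesis by force
  qed
  have eq0: "sup_norm U f = 0 \<longleftrightarrow> f = 0" if f: "f \<in> ?H" for f
  proof
    assume "sup_norm U f = 0"
    then have "f x = 0" for x
      using norm_le_sup_norm[OF f, of x] hol_outside[OF hol_bdd_imp_hol[OF f], of x] by (cases "x \<in> U") auto
    then show "f = 0" by (simp add: fun_eq_iff)
  next
    assume "f = 0"
    then show "sup_norm U f = 0" using scale_eq[OF zero, of 0] by simp
  qed
  show ?thesis
    unfolding normed_space_on_def complex_vector.subspace_def
    using zero add scale scale_eq eq0 sup_norm_nonneg by auto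
qed

lemmas subspace_hol_bdd = normed_space_on_subspace[OF normed_space_on_hol_bdd]

lemma hol_bdd_compose:
  fixes f :: "'e::complex_banach \<Rightarrow> 'f::complex_banach"
  assumes f: "f \<in> hol_bdd U" and y: "y \<in> dualF"
  shows "(\<lambda>x. y (f x)) \<in> hol_bdd U" "sup_norm U (\<lambda>x. y (f x)) \<le> dualF_norm y * sup_norm U f"
proof -
  have y0: "0 \<le> dualF_norm y" using y by (rule dual_norm_nonneg[OF normed_space_on_UNIV])
  have le: "cmod (y (f x)) \<le> dualF_norm y * sup_norm U f" if "x \<in> U" for x
    using cmod_dual_le[OF y, of "f x"] mult_left_mono[OF norm_le_sup_norm[OF f that] y0] by simp
  have "\<exists>A. clinear_on UNIV A \<and> ((\<lambda>x. y (f x)) has_derivative A) (at x)" if x: "x \<in> U" for x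
  proof -
    obtain A where A: "clinear_on UNIV A" "(f has_derivative A) (at x)"
      using hol_bdd_imp_hol[OF f] x by (rule hol_derivative)
    have "clinear_on UNIV (\<lambda>v. y (A v))"
      using A(1) by (simp add: clinear_on_def dual_add[OF y] dual_scale[OF y] scaleC_complex_def)
    moreover have "((\<lambda>x. y (f x)) has_derivative (\<lambda>v. y (A v))) (at x)"
      using bounded_linear_dual[OF y] A(2) by (rule bounded_linear.has_derivative)
    ultimately show ?thesis by blast
  qed
  then have "(\<lambda>x. y (f x)) \<in> hol U"
    using hol_outside[OF hol_bdd_imp_hol[OF f]] dual_zero[OF y] by (auto simp: hol_def)
  then show "(\<lambda>x. y (f x)) \<in> hol_bdd U" using le by (rule hol_bddI)
  show "sup_norm U (\<lambda>x. y (f x)) \<le> dualF_norm y * sup_norm U f"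
    using le y0 sup_norm_nonneg[OF f] by (intro sup_norm_le) auto
qed

section \<open>The predual of the space of bounded holomorphic functions\<close>

abbreviation Hinf_dual :: "'e::complex_banach set \<Rightarrow> (('e \<Rightarrow> complex) \<Rightarrow> complex) set" where
  "Hinf_dual U \<equiv> dual (hol_bdd U) (sup_norm U)"

lemma normed_space_on_Hinf_dual: "normed_space_on (Hinf_dual U) (G_norm U)"
  unfolding G_norm_def by (rule normed_space_on_dual[OF normed_space_on_hol_bdd])

lemma G_norm_bound: "\<phi> \<in> Hinf_dual U \<Longrightarrow> h \<in> hol_bdd U \<Longrightarrow> cmod (\<phi> h) \<le> G_norm U \<phi> * sup_norm U h"
  unfolding G_norm_def by (rule dual_norm_bound[OF normed_space_on_hol_bdd])

lemma G_norm_le: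
  "0 \<le> K \<Longrightarrow> (\<And>h. h \<in> hol_bdd U \<Longrightarrow> cmod (\<phi> h) \<le> K * sup_norm U h) \<Longrightarrow> G_norm U \<phi> \<le> K"
  unfolding G_norm_def by (rule dual_norm_le[OF normed_space_on_hol_bdd])

lemma evaluation_in_dual:
  assumes x: "x \<in> U"
  shows "evaluation U x \<in> Hinf_dual U"
proof (rule dualI[where K = 1])
  have "evaluation U x (a *\<^sub>C h) = a *\<^sub>C evaluation U x h" if "h \<in> hol_bdd U" for a h
  proof -
    have "a *\<^sub>C h \<in> hol_bdd U" using subspace_hol_bdd that by (rule complex_vector.subspace_scale)
    with that show ?thesis by (simp add: evaluation_def scaleC_fun_def)
  qed
  then show "clinear_on (hol_bdd U) (evaluation U x)"
    by (simp add: evaluation_def clinear_on_def complex_vector.subspace_add[OF subspace_hol_bdd])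
qed (use x in \<open>auto simp: evaluation_def norm_le_sup_norm\<close>)

lemma G_norm_evaluation_le: "x \<in> U \<Longrightarrow> G_norm U (evaluation U x) \<le> 1"
  by (rule G_norm_le) (auto simp: evaluation_def norm_le_sup_norm)

lemma span_evaluation_subset: "complex_vector.span (evaluation U ` U) \<subseteq> Hinf_dual U"
  by (rule complex_vector.span_minimal)
    (auto simp: evaluation_in_dual normed_space_on_subspace[OF normed_space_on_Hinf_dual])

lemma G_space_subset: "G_space U \<subseteq> Hinf_dual U"
  by (auto simp: G_space_def)

lemma span_subset_G_space: "complex_vector.span (evaluation U ` U) \<subseteq> G_space U"
  using span_evaluation_subset[of U] normed_space_on_zero[OF normed_space_on_Hinf_dual, of U]
  by (force simp: G_space_def)

lemma evaluation_in_G_space: "x \<in> U \<Longrightarrow> evaluation U x \<in> G_space U"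
  using span_subset_G_space by (auto intro: complex_vector.span_base)

lemma G_space_approx:
  assumes "\<phi> \<in> G_space U" "0 < \<epsilon>"
  obtains \<psi> where "\<psi> \<in> complex_vector.span (evaluation U ` U)" "G_norm U (\<phi> - \<psi>) < \<epsilon>"
  using assms by (auto simp: G_space_def)

lemma subspace_G_space: "complex_vector.subspace (G_space U)"
  unfolding complex_vector.subspace_def
proof (intro conjI ballI allI)
  note D = normed_space_on_Hinf_dual[of U] and S = normed_space_on_subspace[OF normed_space_on_Hinf_dual[of U]]
  show "0 \<in> G_space U"
    using span_subset_G_space complex_vector.span_zero by blast
  fix \<phi> assume \<phi>: "\<phi> \<in> G_space U"
  have \<phi>': "\<phi> \<in> Hinf_dual U" using \<phi> G_space_subset by blast
  show "\<phi> + \<psi> \<in> G_space U" if \<psi>: "\<psi> \<in> G_space U" for \<psi>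
  proof -
    have \<psi>': "\<psi> \<in> Hinf_dual U" using \<psi> G_space_subset by blast
    have "\<exists>\<zeta>\<in>complex_vector.span (evaluation U ` U). G_norm U (\<phi> + \<psi> - \<zeta>) < \<epsilon>" if e: "0 < \<epsilon>" for \<epsilon> :: real
    proof -
      have e2: "0 < \<epsilon> / 2" using e by simp
      obtain a where a: "a \<in> complex_vector.span (evaluation U ` U)" "G_norm U (\<phi> - a) < \<epsilon> / 2"
        using \<phi> e2 by (rule G_space_approx)
      obtain b where b: "b \<in> complex_vector.span (evaluation U ` U)" "G_norm U (\<psi> - b) < \<epsilon> / 2"
        using \<psi> e2 by (rule G_space_approx)
      have "G_norm U ((\<phi> - a) + (\<psi> - b)) \<le> G_norm U (\<phi> - a) + G_norm U (\<psi> - b)"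
        using a b \<phi>' \<psi>' span_evaluation_subset[of U]
        by (intro normed_space_on_triangle[OF D] complex_vector.subspace_diff[OF S]) auto
      then have "G_norm U (\<phi> + \<psi> - (a + b)) < \<epsilon>"
        using a b by (simp add: algebra_simps)
      then show ?thesis using a b complex_vector.span_add by blast
    qed
    then show ?thesis using complex_vector.subspace_add[OF S \<phi>' \<psi>'] by (simp add: G_space_def)
  qed
  show "c *\<^sub>C \<phi> \<in> G_space U" for c
  proof (cases "c = 0")
    case True
    then show ?thesis using span_subset_G_space[of U] complex_vector.span_zero[of "evaluation U ` U"] by auto
  next
    case False
    have "\<exists>\<zeta>\<in>complex_vector.span (evaluation U ` U). G_norm U (c *\<^sub>C \<phi> - \<zeta>) < \<epsilon>" if e: "0 < \<epsilon>" for \<epsilon> :: real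
    proof -
      have e2: "0 < \<epsilon> / cmod c" using e False by simp
      obtain a where a: "a \<in> complex_vector.span (evaluation U ` U)" "G_norm U (\<phi> - a) < \<epsilon> / cmod c"
        using \<phi> e2 by (rule G_space_approx)
      have "G_norm U (c *\<^sub>C (\<phi> - a)) = cmod c * G_norm U (\<phi> - a)"
        using a \<phi>' span_evaluation_subset[of U]
        by (intro normed_space_on_scale[OF D] complex_vector.subspace_diff[OF S]) auto
      then have "G_norm U (c *\<^sub>C \<phi> - c *\<^sub>C a) < \<epsilon>"
        using a False by (simp add: complex_vector.scale_right_diff_distrib field_simps)
      then show ?thesis using a complex_vector.span_scale by blast
    qed
    then show ?thesis using complex_vector.subspace_scale[OF S \<phi>'] by (simp add: G_space_def)
  qed
qed

lemma normed_space_on_G_space: "normed_space_on (G_space U) (G_norm U)"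
  by (rule normed_space_on_subset[OF normed_space_on_Hinf_dual subspace_G_space G_space_subset])

text \<open>
  The span of the evaluations is dense, so a bounded operator on the predual is determined by its values
  on them. All identifications of operators below rest on this.
\<close>

lemma G_ops_eqI:
  fixes S T :: "(('e::complex_banach \<Rightarrow> complex) \<Rightarrow> complex) \<Rightarrow> 'f::complex_banach"
  assumes S: "S \<in> bounded_ops (G_space U) (G_norm U)" and T: "T \<in> bounded_ops (G_space U) (G_norm U)"
    and eq: "\<And>x. x \<in> U \<Longrightarrow> S (evaluation U x) = T (evaluation U x)"
  shows "S = T"
proof -
  note G = normed_space_on_G_space[of U] and sub = subspace_G_space[of U]
  define D where "D = S - T"
  have D: "D \<in> bounded_ops (G_space U) (G_norm U)"
    unfolding D_def using S T
    by (rule complex_vector.subspace_diff[OF normed_space_on_subspace[OF normed_space_on_bounded_ops[OF G]]])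
  note cl = bounded_ops_clinear[OF D]
  have "complex_vector.span (evaluation U ` U) \<subseteq> {\<psi> \<in> G_space U. D \<psi> = 0}"
  proof (rule complex_vector.span_minimal)
    show "evaluation U ` U \<subseteq> {\<psi> \<in> G_space U. D \<psi> = 0}"
      using eq by (auto simp: D_def evaluation_in_G_space)
    show "complex_vector.subspace {\<psi> \<in> G_space U. D \<psi> = 0}"
      using sub by (auto simp: complex_vector.subspace_def clinear_on_zero[OF cl sub]
          clinear_on_add[OF cl] clinear_on_scale[OF cl])
  qed
  then have span: "D \<psi> = 0" if "\<psi> \<in> complex_vector.span (evaluation U ` U)" for \<psi> using that by blast
  have "D \<phi> = 0" if \<phi>: "\<phi> \<in> G_space U" for \<phi>
  proof (rule ccontr)
    let ?K = "op_norm (G_space U) (G_norm U) D + 1"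
    have K: "0 < ?K" using op_norm_nonneg[OF G D] by simp
    assume "D \<phi> \<noteq> 0"
    then have "0 < norm (D \<phi>) / ?K" using K by simp
    with \<phi> obtain \<psi> where \<psi>: "\<psi> \<in> complex_vector.span (evaluation U ` U)" "G_norm U (\<phi> - \<psi>) < norm (D \<phi>) / ?K"
      by (rule G_space_approx)
    have \<psi>G: "\<psi> \<in> G_space U" using \<psi> span_subset_G_space by blast
    have diff: "\<phi> - \<psi> \<in> G_space U" using sub \<phi> \<psi>G by (rule complex_vector.subspace_diff)
    have "norm (D \<phi>) = norm (D (\<phi> - \<psi>))" using clinear_on_diff[OF cl sub \<phi> \<psi>G] span[OF \<psi>(1)] by simp
    also have "\<dots> \<le> op_norm (G_space U) (G_norm U) D * G_norm U (\<phi> - \<psi>)" using G D diff by (rule op_norm_bound)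
    also have "\<dots> \<le> ?K * G_norm U (\<phi> - \<psi>)"
      using normed_space_on_nonneg[OF G diff] by (intro mult_right_mono) auto
    also have "\<dots> < norm (D \<phi>)" using \<psi>(2) K by (simp add: field_simps)
    finally show False by simp
  qed
  then show ?thesis
    using bounded_ops_outside[OF S] bounded_ops_outside[OF T] by (fastforce simp: D_def fun_eq_iff)
qed

section \<open>Holomorphy of the evaluation map\<close>

text \<open>
  Taylor's formula with the second derivative controlled by Cauchy's inequality. The bound
  depends on \<open>g\<close> only through \<open>M\<close> and \<open>R\<close>; this uniformity is what turns differentiability of each single
  function into norm differentiability of the evaluation map.
\<close>

lemma holomorphic_remainder_bound:
  assumes g: "g holomorphic_on ball 0 R" and R: "2 < R" and M: "\<And>z. z \<in> ball 0 R \<Longrightarrow> cmod (g z) \<le> M"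
  shows "cmod (g 1 - g 0 - deriv g 0) \<le> 8 * M / R\<^sup>2"
proof -
  have inside: "cball w (R / 2) \<subseteq> ball 0 R" if "w \<in> cball 0 1" for w :: complex
    using that R by (auto simp: dist_norm) (smt (verit) field_sum_of_halves norm_minus_commute norm_triangle_sub)
  have second: "cmod ((deriv ^^ Suc 1) g w) \<le> 8 * M / R\<^sup>2" if w: "w \<in> cball 0 1" for w
  proof -
    have "cmod ((deriv ^^ 2) g w) \<le> fact 2 * M / (R / 2) ^ 2"
    proof (rule Cauchy_inequality)
      show "g holomorphic_on ball w (R / 2)"
        using inside[OF w] by (intro holomorphic_on_subset[OF g]) (auto dest: ball_subset_cball[THEN subsetD])
      show "continuous_on (cball w (R / 2)) g"
        using inside[OF w] by (intro continuous_on_subset[OF holomorphic_on_imp_continuous_on[OF g]])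
      show "cmod (g z) \<le> M" if "cmod (w - z) = R / 2" for z
        using that inside[OF w] by (intro M) (auto simp: dist_norm)
    qed (use R in auto)
    then show ?thesis by (simp add: power_divide numeral_2_eq_2)
  qed
  have "cmod ((deriv ^^ 0) g 1 - (\<Sum>i\<le>1. (deriv ^^ i) g 0 * (1 - 0) ^ i / fact i))
      \<le> 8 * M / R\<^sup>2 * cmod (1 - 0) ^ Suc 1 / fact 1"
  proof (rule complex_Taylor[where S = "cball 0 1" and f = "\<lambda>i. (deriv ^^ i) g"])
    fix i and z :: complex assume z: "z \<in> cball 0 1"
    have "(deriv ^^ i) g holomorphic_on ball 0 R" using g by (rule holomorphic_higher_deriv) simp
    moreover have "z \<in> ball 0 R" using z R by simp
    ultimately show "((deriv ^^ i) g has_field_derivative (deriv ^^ Suc i) g z) (at z within cball 0 1)"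
      by (auto intro: holomorphic_derivI[OF _ open_ball] has_field_derivative_at_within)
  qed (use second in auto)
  then show ?thesis by (simp add: algebra_simps)
qed

lemma holomorphic_deriv_bound:
  assumes g: "g holomorphic_on ball 0 R" and R: "0 < R" and M: "\<And>z. z \<in> ball 0 R \<Longrightarrow> cmod (g z) \<le> M"
  shows "cmod (deriv g 0) \<le> 2 * M / R"
proof -
  have "cmod ((deriv ^^ 1) g 0) \<le> fact 1 * M / (R / 2) ^ 1"
  proof (rule Cauchy_inequality)
    show "g holomorphic_on ball 0 (R / 2)"
      using R by (intro holomorphic_on_subset[OF g]) auto
    show "continuous_on (cball 0 (R / 2)) g"
      using R by (intro continuous_on_subset[OF holomorphic_on_imp_continuous_on[OF g]]) auto
    show "cmod (g z) \<le> M" if "cmod (0 - z) = R / 2" for z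
      using that R by (intro M) auto
  qed (use R in auto)
  then show ?thesis by (simp add: mult.commute)
qed

lemma has_field_derivative_along_line:
  fixes h :: "'e::complex_banach \<Rightarrow> complex"
  assumes A: "clinear_on UNIV A" "(h has_derivative A) (at (x + t *\<^sub>C v))"
  shows "((\<lambda>t. h (x + t *\<^sub>C v)) has_field_derivative A v) (at t)"
proof -
  have "bounded_linear (\<lambda>s :: complex. s *\<^sub>C v)"
    by (rule bounded_linear_clinear[where K = "norm v"])
      (simp_all add: clinear_on_def scaleC_add_left scaleC_complex_def norm_scaleC mult.commute)
  then have "((\<lambda>s. x + s *\<^sub>C v) has_derivative (\<lambda>s. s *\<^sub>C v)) (at t)"
    by (auto intro!: derivative_eq_intros bounded_linear_imp_has_derivative)
  from has_derivative_compose[OF this A(2)]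
  have "((\<lambda>s. h (x + s *\<^sub>C v)) has_derivative (\<lambda>s. A (s *\<^sub>C v))) (at t)" .
  moreover have "(\<lambda>s. A (s *\<^sub>C v)) = (*) (A v)"
    using clinear_on_scale[OF A(1)] by (simp add: fun_eq_iff scaleC_complex_def)
  ultimately show ?thesis by (simp add: has_field_derivative_def)
qed

text \<open>
  The functional \<open>h \<mapsto> dh(x) v\<close>, which is going to be the derivative at \<open>x\<close> of the evaluation map in the
  direction \<open>v\<close>. It is written with a one-variable derivative along the complex line through \<open>x\<close>, so that
  Cauchy's estimates apply to it directly.
\<close>

definition dir_deriv :: "'e::complex_banach set \<Rightarrow> 'e \<Rightarrow> 'e \<Rightarrow> ('e \<Rightarrow> complex) \<Rightarrow> complex" where
  "dir_deriv U x v = (\<lambda>h. if h \<in> hol_bdd U then deriv (\<lambda>t. h (x + t *\<^sub>C v)) 0 else 0)"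

lemma dir_deriv_eq:
  assumes "h \<in> hol_bdd U" "clinear_on UNIV A" "(h has_derivative A) (at x)"
  shows "dir_deriv U x v h = A v"
  using has_field_derivative_along_line[OF assms(2), of h x 0 v] assms(1,3)
  by (simp add: dir_deriv_def DERIV_imp_deriv)

lemma dir_deriv_add:
  assumes "x \<in> U"
  shows "dir_deriv U x (v + w) = dir_deriv U x v + dir_deriv U x w"
proof
  fix h
  show "dir_deriv U x (v + w) h = (dir_deriv U x v + dir_deriv U x w) h"
  proof (cases "h \<in> hol_bdd U")
    case True
    obtain A where A: "clinear_on UNIV A" "(h has_derivative A) (at x)"
      using hol_bdd_imp_hol[OF True] assms by (rule hol_derivative)
    then show ?thesis by (simp add: dir_deriv_eq[OF True A] clinear_on_add)
  qed (simp add: dir_deriv_def)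
qed

lemma dir_deriv_scale:
  assumes "x \<in> U"
  shows "dir_deriv U x (a *\<^sub>C v) = a *\<^sub>C dir_deriv U x v"
proof
  fix h
  show "dir_deriv U x (a *\<^sub>C v) h = (a *\<^sub>C dir_deriv U x v) h"
  proof (cases "h \<in> hol_bdd U")
    case True
    obtain A where A: "clinear_on UNIV A" "(h has_derivative A) (at x)"
      using hol_bdd_imp_hol[OF True] assms by (rule hol_derivative)
    then show ?thesis by (simp add: dir_deriv_eq[OF True A] clinear_on_scale scaleC_fun_def)
  qed (simp add: dir_deriv_def scaleC_fun_def)
qed

context
  fixes U :: "'e::complex_banach set" and x :: 'e and r :: real
  assumes r: "0 < r" and ball: "ball x r \<subseteq> U"
begin

lemma center_in: "x \<in> U"
  using r ball by auto

text \<open>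
  A line in direction \<open>v\<close> stays in the ball of radius \<open>r\<close> while the parameter stays below \<open>r / norm v\<close>,
  which is how small \<open>v\<close> gains the factor \<open>(norm v / r)\<^sup>2\<close> in the remainder.
\<close>

lemma line_holomorphic:
  assumes h: "h \<in> hol_bdd U" and v: "v \<noteq> 0"
  shows "(\<lambda>t. h (x + t *\<^sub>C v)) holomorphic_on ball 0 (r / norm v)"
    and "t \<in> ball 0 (r / norm v) \<Longrightarrow> cmod (h (x + t *\<^sub>C v)) \<le> sup_norm U h"
proof -
  have inU: "x + t *\<^sub>C v \<in> U" if "t \<in> ball 0 (r / norm v)" for t :: complex
    using that v ball by (auto simp: norm_scaleC field_simps dist_norm subset_iff)
  show "(\<lambda>t. h (x + t *\<^sub>C v)) holomorphic_on ball 0 (r / norm v)"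
  proof (rule holomorphic_onI)
    fix t :: complex assume "t \<in> ball 0 (r / norm v)"
    then obtain A where A: "clinear_on UNIV A" "(h has_derivative A) (at (x + t *\<^sub>C v))"
      using hol_derivative[OF hol_bdd_imp_hol[OF h] inU] by metis
    then show "(\<lambda>t. h (x + t *\<^sub>C v)) field_differentiable at t within ball 0 (r / norm v)"
      using has_field_derivative_along_line field_differentiable_at_within field_differentiable_def by blast
  qed
  show "cmod (h (x + t *\<^sub>C v)) \<le> sup_norm U h" if "t \<in> ball 0 (r / norm v)"
    using norm_le_sup_norm[OF h inU[OF that]] .
qed

lemma dir_deriv_bound:
  assumes h: "h \<in> hol_bdd U"
  shows "cmod (dir_deriv U x v h) \<le> (2 * norm v / r) * sup_norm U h"
proof (cases "v = 0")
  case True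
  then show ?thesis by (simp add: dir_deriv_def)
next
  case False
  have "cmod (deriv (\<lambda>t. h (x + t *\<^sub>C v)) 0) \<le> 2 * sup_norm U h / (r / norm v)"
    using line_holomorphic[OF h False] r False by (intro holomorphic_deriv_bound) auto
  then show ?thesis using h by (simp add: dir_deriv_def field_simps)
qed

lemma dir_deriv_remainder:
  assumes h: "h \<in> hol_bdd U" and v: "2 * norm v < r"
  shows "cmod (h (x + v) - h x - dir_deriv U x v h) \<le> (8 * (norm v / r)\<^sup>2) * sup_norm U h"
proof (cases "v = 0")
  case True
  then show ?thesis by (simp add: dir_deriv_def)
next
  case False
  define g where "g t = h (x + t *\<^sub>C v)" for t
  have "cmod (g 1 - g 0 - deriv g 0) \<le> 8 * sup_norm U h / (r / norm v)\<^sup>2"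
    using line_holomorphic[OF h False] v False unfolding g_def
    by (intro holomorphic_remainder_bound) (auto simp: field_simps)
  then show ?thesis using h by (simp add: dir_deriv_def g_def[abs_def] field_simps scaleC_one)
qed

lemma dir_deriv_in_dual: "dir_deriv U x v \<in> Hinf_dual U"
proof (rule dualI[OF _ dir_deriv_bound])
  have *: "dir_deriv U x v (g + h) = dir_deriv U x v g + dir_deriv U x v h"
    if gh: "g \<in> hol_bdd U" "h \<in> hol_bdd U" for g h
  proof -
    obtain A where A: "clinear_on UNIV A" "(g has_derivative A) (at x)"
      using hol_bdd_imp_hol[OF gh(1)] center_in by (rule hol_derivative)
    obtain B where B: "clinear_on UNIV B" "(h has_derivative B) (at x)"
      using hol_bdd_imp_hol[OF gh(2)] center_in by (rule hol_derivative)
    have "g + h \<in> hol_bdd U" using subspace_hol_bdd gh by (rule complex_vector.subspace_add)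
    moreover have "clinear_on UNIV (\<lambda>v. A v + B v)"
      using A(1) B(1) by (simp add: clinear_on_def distrib_left scaleC_complex_def)
    moreover have "((g + h) has_derivative (\<lambda>v. A v + B v)) (at x)"
      unfolding plus_fun_def using A(2) B(2) by (rule has_derivative_add)
    ultimately have "dir_deriv U x v (g + h) = A v + B v" by (rule dir_deriv_eq)
    then show ?thesis using dir_deriv_eq[OF gh(1) A] dir_deriv_eq[OF gh(2) B] by simp
  qed
  moreover have "dir_deriv U x v (a *\<^sub>C h) = a *\<^sub>C dir_deriv U x v h" if h: "h \<in> hol_bdd U" for a h
  proof -
    obtain A where A: "clinear_on UNIV A" "(h has_derivative A) (at x)"
      using hol_bdd_imp_hol[OF h] center_in by (rule hol_derivative)
    have "a *\<^sub>C h \<in> hol_bdd U" using subspace_hol_bdd h by (rule complex_vector.subspace_scale)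
    moreover have "clinear_on UNIV (\<lambda>v. a *\<^sub>C A v)"
      using A(1) by (simp add: clinear_on_def scaleC_add_right mult.commute)
    moreover have "((a *\<^sub>C h) has_derivative (\<lambda>v. a *\<^sub>C A v)) (at x)"
      unfolding scaleC_fun_def using bounded_linear_scaleC A(2) by (rule bounded_linear.has_derivative)
    ultimately have "dir_deriv U x v (a *\<^sub>C h) = a *\<^sub>C A v" by (rule dir_deriv_eq)
    then show ?thesis using dir_deriv_eq[OF h A] by simp
  qed
  ultimately show "clinear_on (hol_bdd U) (dir_deriv U x v)" by (simp add: clinear_on_def)
qed (auto simp: dir_deriv_def)

lemma G_norm_dir_deriv_le: "G_norm U (dir_deriv U x v) \<le> 2 * norm v / r"
  using r by (intro G_norm_le dir_deriv_bound) auto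

lemma G_norm_remainder_le:
  assumes v: "2 * norm v < r"
  shows "G_norm U (evaluation U (x + v) - evaluation U x - dir_deriv U x v) \<le> 8 * (norm v / r)\<^sup>2"
proof (rule G_norm_le)
  fix h :: "'e \<Rightarrow> complex" assume "h \<in> hol_bdd U"
  then show "cmod ((evaluation U (x + v) - evaluation U x - dir_deriv U x v) h)
      \<le> 8 * (norm v / r)\<^sup>2 * sup_norm U h"
    using dir_deriv_remainder[OF _ v] by (simp add: evaluation_def)
qed simp

text \<open>
  The difference quotients of the evaluation map lie in the span of the evaluations and converge in
  norm to the directional derivative, by the uniform remainder estimate.
\<close>

lemma dir_deriv_in_G_space: "dir_deriv U x v \<in> G_space U"
proof -
  note D = normed_space_on_Hinf_dual[of U] and S = normed_space_on_subspace[OF normed_space_on_Hinf_dual[of U]]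
  have "\<exists>\<psi>\<in>complex_vector.span (evaluation U ` U). G_norm U (dir_deriv U x v - \<psi>) < \<epsilon>"
    if e: "0 < \<epsilon>" for \<epsilon>
  proof -
    define c where "c = 8 * (norm v / r)\<^sup>2"
    have c: "0 \<le> c" by (simp add: c_def)
    \<comment> \<open>Small enough for the remainder estimate to apply to \<open>t *\<^sub>C v\<close> and for the quotient to have error below \<open>\<epsilon>\<close>.\<close>
    define t where "t = min (r / (2 * (norm v + 1))) (\<epsilon> / (c + 1))"
    have nv: "0 < 2 * (norm v + 1)" by (simp add: add_nonneg_pos)
    have t: "0 < t" using r e c nv by (simp add: t_def)
    have "t \<le> r / (2 * (norm v + 1))" by (simp add: t_def)
    then have "t * (2 * (norm v + 1)) \<le> r" by (simp only: pos_le_divide_eq[OF nv])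
    then have tv: "2 * norm (complex_of_real t *\<^sub>C v) < r" using t by (simp add: norm_scaleC algebra_simps)
    have "t \<le> \<epsilon> / (c + 1)" by (simp add: t_def)
    moreover have "0 < c + 1" using c by simp
    ultimately have "t * (c + 1) \<le> \<epsilon>" by (simp only: pos_le_divide_eq)
    then have tc: "t * c < \<epsilon>" using t by (simp add: algebra_simps)
    define b where "b = complex_of_real (inverse t)"
    define y where "y = x + complex_of_real t *\<^sub>C v"
    have "norm (complex_of_real t *\<^sub>C v) < r"
      using tv norm_ge_zero[of "complex_of_real t *\<^sub>C v"] by linarith
    then have "y \<in> ball x r" by (simp add: y_def dist_norm)
    then have yU: "y \<in> U" using ball by blast
    define \<rho> where "\<rho> = evaluation U y - evaluation U x - dir_deriv U x (complex_of_real t *\<^sub>C v)"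
    have \<rho>: "\<rho> \<in> Hinf_dual U"
      unfolding \<rho>_def by (intro complex_vector.subspace_diff[OF S] evaluation_in_dual yU center_in dir_deriv_in_dual)
    have "dir_deriv U x v - b *\<^sub>C (evaluation U y - evaluation U x) = (- b) *\<^sub>C \<rho>"
      using t by (simp add: \<rho>_def dir_deriv_scale[OF center_in] b_def complex_vector.scale_right_diff_distrib
          flip: of_real_mult)
    then have "G_norm U (dir_deriv U x v - b *\<^sub>C (evaluation U y - evaluation U x)) = cmod b * G_norm U \<rho>"
      using normed_space_on_scale[OF D \<rho>, of "- b"] by simp
    also have "\<dots> \<le> inverse t * (8 * (norm (complex_of_real t *\<^sub>C v) / r)\<^sup>2)"
      using G_norm_remainder_le[OF tv] t
      by (auto simp: b_def norm_inverse norm_divide \<rho>_def y_def intro!: mult_mono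
          normed_space_on_nonneg[OF D \<rho>, unfolded \<rho>_def y_def])
    also have "\<dots> = t * c" using t by (simp add: c_def norm_scaleC power2_eq_square field_simps)
    also have "\<dots> < \<epsilon>" by (fact tc)
    finally show ?thesis
      using yU center_in
      by (intro bexI[of _ "b *\<^sub>C (evaluation U y - evaluation U x)"] complex_vector.span_scale
          complex_vector.span_diff complex_vector.span_base) auto
  qed
  then show ?thesis by (simp add: G_space_def dir_deriv_in_dual)
qed

end

text \<open>
  The evaluation map is holomorphic as a map into the predual with its norm: its remainder is quadratic,
  uniformly over the unit ball of the bounded holomorphic functions. Composing with \<open>T\<close> preserves this, with
  derivative \<open>v \<mapsto> T (dir_deriv U x v)\<close>.
\<close>

theorem G_op_evaluation_hol_bdd:
  fixes T :: "(('e::complex_banach \<Rightarrow> complex) \<Rightarrow> complex) \<Rightarrow> 'f::complex_banach"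
  assumes U: "open U" and T: "T \<in> bounded_ops (G_space U) (G_norm U)"
  shows "(\<lambda>x. if x \<in> U then T (evaluation U x) else 0) \<in> hol_bdd U" (is "?f \<in> _")
proof -
  note G = normed_space_on_G_space[of U] and sub = subspace_G_space[of U]
  define K where "K = op_norm (G_space U) (G_norm U) T"
  have K: "0 \<le> K" unfolding K_def using G T by (rule op_norm_nonneg)
  have bound: "norm (T \<phi>) \<le> K * G_norm U \<phi>" if "\<phi> \<in> G_space U" for \<phi>
    unfolding K_def using G T that by (rule op_norm_bound)
  note cl = bounded_ops_clinear[OF T]
  have "norm (?f x) \<le> K" if "x \<in> U" for x
    using bound[OF evaluation_in_G_space[OF that]] mult_left_mono[OF G_norm_evaluation_le[OF that] K] that by simp
  moreover have "\<exists>A. clinear_on UNIV A \<and> (?f has_derivative A) (at x)" if x: "x \<in> U" for x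
  proof -
    obtain r where r: "0 < r" and ball: "ball x r \<subseteq> U" using U x by (auto simp: open_contains_ball)
    define A where "A v = T (dir_deriv U x v)" for v
    note inG = dir_deriv_in_G_space[OF r ball]
    have A: "clinear_on UNIV A"
      using inG by (simp add: A_def clinear_on_def dir_deriv_add[OF x] dir_deriv_scale[OF x]
          clinear_on_add[OF cl] clinear_on_scale[OF cl])
    have "norm (A v) \<le> K * (2 / r) * norm v" for v
      using bound[OF inG, of v] mult_left_mono[OF G_norm_dir_deriv_le[OF r ball, of v] K] by (simp add: A_def)
    with A have bl: "bounded_linear A" by (rule bounded_linear_clinear)
    have rem: "norm (?f (x + v) - ?f x - A v) \<le> K * (8 * (norm v / r)\<^sup>2)" if v: "2 * norm v < r" for v
    proof -
      have "norm v < r" using v norm_ge_zero[of v] by linarith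
      then have "x + v \<in> ball x r" by (simp add: dist_norm)
      then have y: "x + v \<in> U" using ball by blast
      let ?\<rho> = "evaluation U (x + v) - evaluation U x - dir_deriv U x v"
      have "?f (x + v) - ?f x - A v = T ?\<rho>"
        using x y by (simp add: A_def clinear_on_diff[OF cl sub] evaluation_in_G_space inG
            complex_vector.subspace_diff[OF sub])
      also have "norm \<dots> \<le> K * G_norm U ?\<rho>"
        by (intro bound complex_vector.subspace_diff[OF sub] evaluation_in_G_space x y inG)
      also have "\<dots> \<le> K * (8 * (norm v / r)\<^sup>2)"
        using G_norm_remainder_le[OF r ball v] K by (rule mult_left_mono)
      finally show ?thesis .
    qed
    have "(?f has_derivative A) (at x)"
      unfolding has_derivative_at_alt
    proof (intro conjI allI impI bl)
      fix e :: real assume e: "0 < e"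
      define c where "c = K * (8 / r\<^sup>2)"
      have c: "0 \<le> c" using K by (simp add: c_def)
      define d where "d = min (r / 2) (e / (c + 1))"
      have d: "0 < d" using r e c by (simp add: d_def)
      have "norm (?f y - ?f x - A (y - x)) \<le> e * norm (y - x)" if y: "norm (y - x) < d" for y
      proof -
        have "norm (?f (x + (y - x)) - ?f x - A (y - x)) \<le> K * (8 * (norm (y - x) / r)\<^sup>2)"
          using y by (intro rem) (simp add: d_def)
        also have "\<dots> = c * norm (y - x) * norm (y - x)" by (simp add: c_def power2_eq_square)
        also have "\<dots> \<le> e * norm (y - x)"
        proof (rule mult_right_mono)
          have "c * norm (y - x) \<le> (c + 1) * (e / (c + 1))"
            using y c by (intro mult_mono) (auto simp: d_def)
          then show "c * norm (y - x) \<le> e" using c by simp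
        qed simp
        finally show ?thesis by (simp only: add_diff_cancel_left' add.commute[of x] diff_add_cancel)
      qed
      then show "\<exists>d>0. \<forall>y. norm (y - x) < d \<longrightarrow> norm (?f y - ?f x - A (y - x)) \<le> e * norm (y - x)"
        using d by blast
    qed
    with A show ?thesis by blast
  qed
  then have "?f \<in> hol U" by (auto simp: hol_def)
  ultimately show ?thesis by (intro hol_bddI)
qed

section \<open>Linearization\<close>

lemma norm_le_of_weak_pairing:
  fixes f :: "'e::complex_banach \<Rightarrow> 'f::complex_banach"
  assumes f: "f \<in> hol_bdd U" and \<phi>: "\<phi> \<in> Hinf_dual U"
    and z: "\<And>y. y \<in> dualF \<Longrightarrow> y z = \<phi> (\<lambda>x. y (f x))"
  shows "norm z \<le> sup_norm U f * G_norm U \<phi>"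
proof -
  obtain y where y: "y \<in> dualF" "dualF_norm y \<le> 1" "y z = complex_of_real (norm z)"
    by (rule norming_functional)
  have "norm z = cmod (\<phi> (\<lambda>x. y (f x)))" by (simp add: y(3) flip: z[OF y(1)])
  also have "\<dots> \<le> G_norm U \<phi> * sup_norm U (\<lambda>x. y (f x))"
    using \<phi> hol_bdd_compose(1)[OF f y(1)] by (rule G_norm_bound)
  also have "\<dots> \<le> G_norm U \<phi> * (1 * sup_norm U f)"
    using hol_bdd_compose(2)[OF f y(1)] mult_right_mono[OF y(2) sup_norm_nonneg[OF f]]
    by (intro mult_left_mono normed_space_on_nonneg[OF normed_space_on_Hinf_dual \<phi>]) auto
  finally show ?thesis by (simp add: mult.commute)
qed

text \<open>
  For an evaluation at \<open>x\<close> the vector is \<open>f x\<close>, and vectors for combinations are the same combinations.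
  For a norm limit of such combinations the vectors form a Cauchy sequence, by the preceding estimate, and the
  completeness of the target space supplies the limit.
\<close>

lemma weak_pairing_exists:
  fixes f :: "'e::complex_banach \<Rightarrow> 'f::complex_banach"
  assumes f: "f \<in> hol_bdd U" and \<phi>: "\<phi> \<in> G_space U"
  obtains z where "\<And>y. y \<in> dualF \<Longrightarrow> y z = \<phi> (\<lambda>x. y (f x))"
proof -
  define P where "P \<psi> z \<longleftrightarrow> (\<forall>y\<in>dualF. y z = \<psi> (\<lambda>x. y (f x)))" for \<psi> :: "('e \<Rightarrow> complex) \<Rightarrow> complex" and z :: 'f
  note D = normed_space_on_Hinf_dual[of U] and S = normed_space_on_subspace[OF normed_space_on_Hinf_dual[of U]]
  note comp = hol_bdd_compose[OF f]
  define s where "s = sup_norm U f"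
  have s: "0 \<le> s" unfolding s_def using f by (rule sup_norm_nonneg)
  have "complex_vector.span (evaluation U ` U) \<subseteq> {\<psi>. \<exists>z. P \<psi> z}"
  proof (rule complex_vector.span_minimal)
    show "evaluation U ` U \<subseteq> {\<psi>. \<exists>z. P \<psi> z}"
      using comp by (auto simp: P_def evaluation_def)
    have zero: "P 0 0" by (auto simp: P_def dual_zero)
    have add: "P (\<psi> + \<omega>) (z + w)" if "P \<psi> z" "P \<omega> w" for \<psi> \<omega> z w
      using that by (simp add: P_def dual_add)
    have scale: "P (a *\<^sub>C \<psi>) (a *\<^sub>C z)" if "P \<psi> z" for a \<psi> z
      using that by (simp add: P_def dual_scale scaleC_fun_def scaleC_complex_def)
    show "complex_vector.subspace {\<psi>. \<exists>z. P \<psi> z}"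
      unfolding complex_vector.subspace_def using zero add scale by blast
  qed
  then have span: "\<exists>z. P \<psi> z" if "\<psi> \<in> complex_vector.span (evaluation U ` U)" for \<psi> using that by blast
  have "\<exists>\<psi> z. \<psi> \<in> Hinf_dual U \<and> G_norm U (\<phi> - \<psi>) < inverse (real (Suc n)) \<and> P \<psi> z" for n
  proof -
    have "0 < inverse (real (Suc n))" by simp
    with \<phi> obtain \<psi> where "\<psi> \<in> complex_vector.span (evaluation U ` U)" "G_norm U (\<phi> - \<psi>) < inverse (real (Suc n))"
      by (rule G_space_approx)
    then show ?thesis using span span_evaluation_subset by blast
  qed
  then obtain \<psi> z where \<psi>: "\<And>n. \<psi> n \<in> Hinf_dual U" "\<And>n. G_norm U (\<phi> - \<psi> n) < inverse (real (Suc n))"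
    and z: "\<And>n. P (\<psi> n) (z n)" by metis
  have \<phi>': "\<phi> \<in> Hinf_dual U" using \<phi> G_space_subset by blast
  have diff: "norm (z m - z n) \<le> s * (inverse (real (Suc m)) + inverse (real (Suc n)))" for m n
  proof -
    have "norm (z m - z n) \<le> s * G_norm U (\<psi> m - \<psi> n)"
      unfolding s_def using z[of m] z[of n]
      by (intro norm_le_of_weak_pairing[OF f] complex_vector.subspace_diff[OF S] \<psi>) (simp add: P_def dual_diff)
    also have "G_norm U ((\<phi> - \<psi> n) - (\<phi> - \<psi> m)) \<le> G_norm U (\<phi> - \<psi> n) + G_norm U (\<phi> - \<psi> m)"
      by (intro normed_space_on_triangle_diff[OF D] complex_vector.subspace_diff[OF S] \<psi> \<phi>')
    then have "s * G_norm U (\<psi> m - \<psi> n) \<le> s * (inverse (real (Suc m)) + inverse (real (Suc n)))"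
      using \<psi>(2)[of m] \<psi>(2)[of n] s by (intro mult_left_mono) auto
    finally show ?thesis .
  qed
  have "Cauchy z"
  proof (rule CauchyI)
    fix e :: real assume "0 < e"
    then have "0 < e / (2 * s + 1)" using s by simp
    then obtain M where M: "inverse (real (Suc M)) < e / (2 * s + 1)" using reals_Archimedean by blast
    have "norm (z m - z n) < e" if "M \<le> m" "M \<le> n" for m n
    proof -
      have inv: "inverse (real (Suc k)) \<le> inverse (real (Suc M))" if "M \<le> k" for k
        using that by (intro le_imp_inverse_le) auto
      have "norm (z m - z n) \<le> s * (inverse (real (Suc M)) + inverse (real (Suc M)))"
        using diff[of m n] mult_left_mono[OF add_mono[OF inv[OF that(1)] inv[OF that(2)]] s] by linarith
      also have "\<dots> \<le> (2 * s + 1) * inverse (real (Suc M))" by (simp add: algebra_simps)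
      also have "\<dots> < e" using M s by (simp add: pos_less_divide_eq mult.commute)
      finally show ?thesis .
    qed
    then show "\<exists>M. \<forall>m\<ge>M. \<forall>n\<ge>M. norm (z m - z n) < e" by blast
  qed
  then obtain l where l: "z \<longlonglongrightarrow> l" using Cauchy_convergent convergent_def by blast
  show thesis
  proof (rule that[of l])
    fix y :: "'f \<Rightarrow> complex" assume y: "y \<in> dualF"
    let ?h = "\<lambda>x. y (f x)"
    have "(\<lambda>n. y (z n)) \<longlonglongrightarrow> y l" using bounded_linear.tendsto[OF bounded_linear_dual[OF y] l] .
    moreover have "(\<lambda>n. y (z n)) \<longlonglongrightarrow> \<phi> ?h"
    proof (rule LIM_zero_cancel, rule Lim_null_comparison)
      have "norm (y (z n) - \<phi> ?h) \<le> inverse (real (Suc n)) * sup_norm U ?h" for n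
      proof -
        have "norm (y (z n) - \<phi> ?h) = cmod ((\<phi> - \<psi> n) ?h)"
          using z[of n] y by (simp add: P_def norm_minus_commute)
        also have "\<dots> \<le> G_norm U (\<phi> - \<psi> n) * sup_norm U ?h"
          by (intro G_norm_bound complex_vector.subspace_diff[OF S] \<phi>' \<psi> comp y)
        also have "\<dots> \<le> inverse (real (Suc n)) * sup_norm U ?h"
          using \<psi>(2)[of n] by (intro mult_right_mono sup_norm_nonneg comp y) auto
        finally show ?thesis .
      qed
      then show "\<forall>\<^sub>F n in sequentially. norm (y (z n) - \<phi> ?h) \<le> inverse (real (Suc n)) * sup_norm U ?h"
        by simp
      show "(\<lambda>n. inverse (real (Suc n)) * sup_norm U ?h) \<longlonglongrightarrow> 0"
        by (rule tendsto_mult_left_zero[OF LIMSEQ_inverse_real_of_nat])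
    qed
    ultimately show "y l = \<phi> ?h" by (rule LIMSEQ_unique)
  qed
qed

text \<open>
  The operator sends \<open>\<phi>\<close> to the vector that represents \<open>y \<mapsto> \<phi> (y \<circ> f)\<close>. Since functionals separate
  points, this vector is unique, and linearity in \<open>\<phi>\<close> comes for free.
\<close>

lemma linearization_exists:
  fixes f :: "'e::complex_banach \<Rightarrow> 'f::complex_banach"
  assumes f: "f \<in> hol_bdd U"
  shows "\<exists>T \<in> bounded_ops (G_space U) (G_norm U). \<forall>x\<in>U. T (evaluation U x) = f x"
proof -
  have "\<exists>z. \<forall>y\<in>dualF. y z = \<phi> (\<lambda>x. y (f x))" if "\<phi> \<in> G_space U" for \<phi>
    using weak_pairing_exists[OF f that] by metis
  then obtain T0 where T0: "\<And>\<phi> y. \<phi> \<in> G_space U \<Longrightarrow> y \<in> dualF \<Longrightarrow> y (T0 \<phi>) = \<phi> (\<lambda>x. y (f x))"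
    by metis
  define T where "T \<phi> = (if \<phi> \<in> G_space U then T0 \<phi> else 0)" for \<phi>
  have T: "y (T \<phi>) = \<phi> (\<lambda>x. y (f x))" if "\<phi> \<in> G_space U" "y \<in> dualF" for \<phi> y
    using T0 that by (simp add: T_def)
  note add = complex_vector.subspace_add[OF subspace_G_space] and scale = complex_vector.subspace_scale[OF subspace_G_space]
  have "T \<in> bounded_ops (G_space U) (G_norm U)"
  proof (rule bounded_opsI)
    show "clinear_on (G_space U) T"
      unfolding clinear_on_def
    proof (intro conjI ballI allI)
      fix \<phi> \<psi> assume "\<phi> \<in> G_space U" "\<psi> \<in> G_space U"
      then show "T (\<phi> + \<psi>) = T \<phi> + T \<psi>"
        by - (rule dual_separates, simp add: T add dual_add)
    next
      fix a \<phi> assume "\<phi> \<in> G_space U"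
      then show "T (a *\<^sub>C \<phi>) = a *\<^sub>C T \<phi>"
        by - (rule dual_separates, simp add: T scale dual_scale, simp add: scaleC_fun_def scaleC_complex_def)
    qed
    show "norm (T \<phi>) \<le> sup_norm U f * G_norm U \<phi>" if "\<phi> \<in> G_space U" for \<phi>
      using that G_space_subset T by (intro norm_le_of_weak_pairing[OF f]) auto
  qed (simp add: T_def)
  moreover have "T (evaluation U x) = f x" if "x \<in> U" for x
    using that hol_bdd_compose(1)[OF f]
    by - (rule dual_separates, simp add: T evaluation_in_G_space, simp add: evaluation_def)
  ultimately show ?thesis by blast
qed

lemma linearization_eqI:
  assumes "T \<in> bounded_ops (G_space U) (G_norm U)" "\<And>x. x \<in> U \<Longrightarrow> T (evaluation U x) = f x"
  shows "linearization U f = T"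
  unfolding linearization_def
  by (rule the_equality) (use assms in \<open>auto intro: G_ops_eqI\<close>)

lemma
  assumes "f \<in> hol_bdd U"
  shows linearization_in: "linearization U f \<in> bounded_ops (G_space U) (G_norm U)"
    and linearization_evaluation: "x \<in> U \<Longrightarrow> linearization U f (evaluation U x) = f x"
proof -
  obtain T where T: "T \<in> bounded_ops (G_space U) (G_norm U)" "\<And>x. x \<in> U \<Longrightarrow> T (evaluation U x) = f x"
    using linearization_exists[OF assms] by blast
  have "linearization U f = T" using T by (rule linearization_eqI)
  with T show "linearization U f \<in> bounded_ops (G_space U) (G_norm U)"
    and "x \<in> U \<Longrightarrow> linearization U f (evaluation U x) = f x" by auto
qed

section \<open>The unit ball of the predual\<close>

text \<open>
  The functionals with \<open>atomic_le U \<psi> 1\<close> are the absolutely convex hull of the evaluations.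
\<close>

definition atomic_le :: "'e::complex_banach set \<Rightarrow> (('e \<Rightarrow> complex) \<Rightarrow> complex) \<Rightarrow> real \<Rightarrow> bool" where
  "atomic_le U \<psi> s \<longleftrightarrow>
    (\<exists>A c. finite A \<and> A \<subseteq> U \<and> \<psi> = (\<Sum>u\<in>A. c u *\<^sub>C evaluation U u) \<and> (\<Sum>u\<in>A. cmod (c u)) \<le> s)"

lemma atomic_le_nonneg: "atomic_le U \<psi> s \<Longrightarrow> 0 \<le> s"
  unfolding atomic_le_def by (meson norm_ge_zero order_trans sum_nonneg)

lemma atomic_le_in_G_space: "atomic_le U \<psi> s \<Longrightarrow> \<psi> \<in> G_space U"
  unfolding atomic_le_def
  by (auto intro!: complex_vector.subspace_sum[OF subspace_G_space]
      complex_vector.subspace_scale[OF subspace_G_space] evaluation_in_G_space)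

lemma atomic_le_zero: "atomic_le U 0 0"
  unfolding atomic_le_def by (intro exI[of _ "{}"]) auto

lemma atomic_le_evaluation: "x \<in> U \<Longrightarrow> atomic_le U (evaluation U x) 1"
  unfolding atomic_le_def by (intro exI[of _ "{x}"] exI[of _ "\<lambda>_. 1"]) auto

lemma atomic_le_add:
  assumes "atomic_le U \<psi> s" "atomic_le U \<omega> t"
  shows "atomic_le U (\<psi> + \<omega>) (s + t)"
proof -
  obtain A c where A: "finite A" "A \<subseteq> U" "\<psi> = (\<Sum>u\<in>A. c u *\<^sub>C evaluation U u)" "(\<Sum>u\<in>A. cmod (c u)) \<le> s"
    using assms(1) by (auto simp: atomic_le_def)
  obtain B d where B: "finite B" "B \<subseteq> U" "\<omega> = (\<Sum>u\<in>B. d u *\<^sub>C evaluation U u)" "(\<Sum>u\<in>B. cmod (d u)) \<le> t"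
    using assms(2) by (auto simp: atomic_le_def)
  define c' where "c' u = (if u \<in> A then c u else 0)" for u
  define d' where "d' u = (if u \<in> B then d u else 0)" for u
  have "(\<Sum>u\<in>A. c u *\<^sub>C evaluation U u) = (\<Sum>u\<in>A \<union> B. c' u *\<^sub>C evaluation U u)"
    "(\<Sum>u\<in>A. cmod (c u)) = (\<Sum>u\<in>A \<union> B. cmod (c' u))"
    using A(1) B(1) by (auto simp: c'_def intro!: sum.mono_neutral_cong_left)
  moreover have "(\<Sum>u\<in>B. d u *\<^sub>C evaluation U u) = (\<Sum>u\<in>A \<union> B. d' u *\<^sub>C evaluation U u)"
    "(\<Sum>u\<in>B. cmod (d u)) = (\<Sum>u\<in>A \<union> B. cmod (d' u))"
    using A(1) B(1) by (auto simp: d'_def intro!: sum.mono_neutral_cong_left)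
  moreover have "(\<Sum>u\<in>A \<union> B. cmod (c' u + d' u)) \<le> (\<Sum>u\<in>A \<union> B. cmod (c' u)) + (\<Sum>u\<in>A \<union> B. cmod (d' u))"
    by (simp add: sum.distrib[symmetric] sum_mono norm_triangle_ineq)
  ultimately show ?thesis
    unfolding atomic_le_def using A B
    by (intro exI[of _ "A \<union> B"] exI[of _ "\<lambda>u. c' u + d' u"]) (auto simp: scaleC_add_left sum.distrib)
qed

lemma atomic_le_scale:
  assumes "atomic_le U \<psi> s"
  shows "atomic_le U (a *\<^sub>C \<psi>) (cmod a * s)"
proof -
  obtain A c where A: "finite A" "A \<subseteq> U" "\<psi> = (\<Sum>u\<in>A. c u *\<^sub>C evaluation U u)" "(\<Sum>u\<in>A. cmod (c u)) \<le> s"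
    using assms(1) by (auto simp: atomic_le_def)
  then show ?thesis
    unfolding atomic_le_def
    by (intro exI[of _ A] exI[of _ "\<lambda>u. a * c u"])
      (auto simp: complex_vector.scale_sum_right norm_mult simp flip: sum_distrib_left intro!: mult_left_mono)
qed

lemma G_norm_diff_atomic_nonneg:
  "\<phi> \<in> G_space U \<Longrightarrow> atomic_le U \<psi> s \<Longrightarrow> 0 \<le> G_norm U (\<phi> - \<psi>)"
  using atomic_le_in_G_space complex_vector.subspace_diff[OF subspace_G_space]
  by (blast intro: normed_space_on_nonneg[OF normed_space_on_G_space])

text \<open>
  An infimal convolution: a functional is split into a combination of evaluations, paid by the sum
  of its coefficients, and a rest, paid by its norm times \<open>1 / \<eta>\<close>. The second term makes the seminorm continuous for
  the norm of the predual, without which a dominated functional need not be bounded.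
\<close>

definition atomic_gauge :: "'e::complex_banach set \<Rightarrow> real \<Rightarrow> (('e \<Rightarrow> complex) \<Rightarrow> complex) \<Rightarrow> real" where
  "atomic_gauge U \<eta> \<phi> = Inf {s + G_norm U (\<phi> - \<psi>) / \<eta> | \<psi> s. atomic_le U \<psi> s}"

context
  fixes U :: "'e::complex_banach set" and \<eta> :: real
  assumes \<eta>: "0 < \<eta>"
begin

lemma atomic_gauge_set_nonneg:
  "\<phi> \<in> G_space U \<Longrightarrow> atomic_le U \<psi> s \<Longrightarrow> 0 \<le> s + G_norm U (\<phi> - \<psi>) / \<eta>"
  using \<eta> atomic_le_nonneg[of U \<psi> s] G_norm_diff_atomic_nonneg[of \<phi> U \<psi> s] by simp

lemma atomic_gauge_le:
  assumes "\<phi> \<in> G_space U" "atomic_le U \<psi> s"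
  shows "atomic_gauge U \<eta> \<phi> \<le> s + G_norm U (\<phi> - \<psi>) / \<eta>"
  unfolding atomic_gauge_def using assms atomic_gauge_set_nonneg[OF assms(1)]
  by (intro cInf_lower) (auto intro: bdd_belowI[of _ 0])

lemma atomic_gauge_greatest:
  assumes "\<And>\<psi> s. atomic_le U \<psi> s \<Longrightarrow> c \<le> s + G_norm U (\<phi> - \<psi>) / \<eta>"
  shows "c \<le> atomic_gauge U \<eta> \<phi>"
  unfolding atomic_gauge_def using assms atomic_le_zero by (intro cInf_greatest) blast+

lemma atomic_gauge_triangle:
  assumes \<phi>: "\<phi> \<in> G_space U" "\<phi>' \<in> G_space U"
  shows "atomic_gauge U \<eta> (\<phi> + \<phi>') \<le> atomic_gauge U \<eta> \<phi> + atomic_gauge U \<eta> \<phi>'"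
proof -
  note G = subspace_G_space[of U]
  have *: "atomic_gauge U \<eta> (\<phi> + \<phi>') \<le> (s + G_norm U (\<phi> - \<psi>) / \<eta>) + (s' + G_norm U (\<phi>' - \<psi>') / \<eta>)"
    if a: "atomic_le U \<psi> s" "atomic_le U \<psi>' s'" for \<psi> s \<psi>' s'
  proof -
    have "atomic_gauge U \<eta> (\<phi> + \<phi>') \<le> s + s' + G_norm U ((\<phi> + \<phi>') - (\<psi> + \<psi>')) / \<eta>"
      using \<phi> a by (intro atomic_gauge_le atomic_le_add complex_vector.subspace_add[OF G])
    moreover have "G_norm U ((\<phi> - \<psi>) + (\<phi>' - \<psi>')) \<le> G_norm U (\<phi> - \<psi>) + G_norm U (\<phi>' - \<psi>')"
      by (intro normed_space_on_triangle[OF normed_space_on_G_space] complex_vector.subspace_diff[OF G]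
          \<phi> atomic_le_in_G_space[OF a(1)] atomic_le_in_G_space[OF a(2)])
    then have "G_norm U ((\<phi> + \<phi>') - (\<psi> + \<psi>')) / \<eta> \<le> G_norm U (\<phi> - \<psi>) / \<eta> + G_norm U (\<phi>' - \<psi>') / \<eta>"
      using \<eta> by (simp add: algebra_simps divide_right_mono flip: add_divide_distrib)
    ultimately show ?thesis by simp
  qed
  have "atomic_gauge U \<eta> (\<phi> + \<phi>') - (s + G_norm U (\<phi> - \<psi>) / \<eta>) \<le> atomic_gauge U \<eta> \<phi>'"
    if "atomic_le U \<psi> s" for \<psi> s
    using *[OF that] by (intro atomic_gauge_greatest) (simp add: algebra_simps)
  then have "atomic_gauge U \<eta> (\<phi> + \<phi>') - atomic_gauge U \<eta> \<phi>' \<le> atomic_gauge U \<eta> \<phi>"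
    by (intro atomic_gauge_greatest) (simp add: algebra_simps)
  then show ?thesis by simp
qed

lemma atomic_gauge_scale_le:
  assumes \<phi>: "\<phi> \<in> G_space U" and a: "a \<noteq> 0"
  shows "atomic_gauge U \<eta> (a *\<^sub>C \<phi>) \<le> cmod a * atomic_gauge U \<eta> \<phi>"
proof -
  note G = subspace_G_space[of U]
  have "atomic_gauge U \<eta> (a *\<^sub>C \<phi>) / cmod a \<le> atomic_gauge U \<eta> \<phi>"
  proof (rule atomic_gauge_greatest)
    fix \<psi> s assume at: "atomic_le U \<psi> s"
    have "atomic_gauge U \<eta> (a *\<^sub>C \<phi>) \<le> cmod a * s + G_norm U (a *\<^sub>C \<phi> - a *\<^sub>C \<psi>) / \<eta>"
      using \<phi> at by (intro atomic_gauge_le atomic_le_scale complex_vector.subspace_scale[OF G])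
    also have "G_norm U (a *\<^sub>C \<phi> - a *\<^sub>C \<psi>) = cmod a * G_norm U (\<phi> - \<psi>)"
      using normed_space_on_scale[OF normed_space_on_G_space, of "\<phi> - \<psi>" U a]
        complex_vector.subspace_diff[OF G \<phi> atomic_le_in_G_space[OF at]]
      by (simp add: complex_vector.scale_right_diff_distrib)
    finally show "atomic_gauge U \<eta> (a *\<^sub>C \<phi>) / cmod a \<le> s + G_norm U (\<phi> - \<psi>) / \<eta>"
      using a \<eta> by (simp add: field_simps)
  qed
  then show ?thesis using a by (simp add: field_simps)
qed

lemma atomic_gauge_zero: "atomic_gauge U \<eta> 0 = 0"
proof (rule antisym)
  have zero: "0 \<in> G_space U" by (rule complex_vector.subspace_0[OF subspace_G_space])
  show "atomic_gauge U \<eta> 0 \<le> 0"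
    using atomic_gauge_le[OF zero atomic_le_zero] normed_space_on_zero[OF normed_space_on_G_space, of U] by simp
  show "0 \<le> atomic_gauge U \<eta> 0"
    using zero by (rule atomic_gauge_greatest[OF atomic_gauge_set_nonneg])
qed

lemma atomic_gauge_scale:
  assumes \<phi>: "\<phi> \<in> G_space U"
  shows "atomic_gauge U \<eta> (a *\<^sub>C \<phi>) = cmod a * atomic_gauge U \<eta> \<phi>"
proof (cases "a = 0")
  case True
  then show ?thesis by (simp add: atomic_gauge_zero)
next
  case False
  have "atomic_gauge U \<eta> (inverse a *\<^sub>C a *\<^sub>C \<phi>) \<le> cmod (inverse a) * atomic_gauge U \<eta> (a *\<^sub>C \<phi>)"
    using False by (intro atomic_gauge_scale_le complex_vector.subspace_scale[OF subspace_G_space] \<phi>) auto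
  then have "cmod a * atomic_gauge U \<eta> \<phi> \<le> atomic_gauge U \<eta> (a *\<^sub>C \<phi>)"
    using False by (simp add: norm_inverse norm_divide field_simps)
  with atomic_gauge_scale_le[OF \<phi> False] show ?thesis by simp
qed

text \<open>
  A Hahn-Banach functional \<open>L\<close> that is dominated by the gauge and attains it at \<open>\<phi>\<close> is bounded, hence
  \<open>h x = L (evaluation U x)\<close> is holomorphic; the gauge of an evaluation is at most one, hence so is \<open>\<bar>h\<bar>\<close>. By density \<open>L\<close>
  is nothing but the pairing with \<open>h\<close>, so that the gauge of \<open>\<phi>\<close> equals \<open>\<bar>\<phi> h\<bar>\<close>, a lower bound of the norm of \<open>\<phi>\<close>.
\<close>

lemma atomic_gauge_le_G_norm:
  assumes U: "open U" and \<phi>: "\<phi> \<in> G_space U"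
  shows "atomic_gauge U \<eta> \<phi> \<le> G_norm U \<phi>"
proof -
  obtain L where L: "clinear_on (G_space U) L" "\<And>\<psi>. \<psi> \<in> G_space U \<Longrightarrow> cmod (L \<psi>) \<le> atomic_gauge U \<eta> \<psi>"
    "L \<phi> = complex_of_real (atomic_gauge U \<eta> \<phi>)"
    using complex_hahn_banach[OF subspace_G_space atomic_gauge_triangle atomic_gauge_scale \<phi>] by blast
  define T where "T \<psi> = (if \<psi> \<in> G_space U then L \<psi> else 0)" for \<psi>
  have T: "T \<in> bounded_ops (G_space U) (G_norm U)"
  proof (rule bounded_opsI)
    show "clinear_on (G_space U) T"
      using L(1) subspace_G_space[of U] by (simp add: T_def clinear_on_def complex_vector.subspace_def)
    show "norm (T \<psi>) \<le> inverse \<eta> * G_norm U \<psi>" if "\<psi> \<in> G_space U" for \<psi>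
      using L(2)[OF that] atomic_gauge_le[OF that atomic_le_zero] that by (simp add: T_def divide_inverse mult.commute)
  qed (simp add: T_def)
  define h where "h x = (if x \<in> U then T (evaluation U x) else 0)" for x
  have h: "h \<in> hol_bdd U"
    using G_op_evaluation_hol_bdd[OF U T] by (simp add: h_def[abs_def])
  have h1: "sup_norm U h \<le> 1"
  proof (rule sup_norm_le)
    fix x assume x: "x \<in> U"
    have "norm (h x) \<le> atomic_gauge U \<eta> (evaluation U x)"
      using x L(2)[OF evaluation_in_G_space[OF x]] by (simp add: h_def T_def evaluation_in_G_space)
    also have "\<dots> \<le> 1"
      using atomic_gauge_le[OF evaluation_in_G_space[OF x] atomic_le_evaluation[OF x]]
        normed_space_on_zero[OF normed_space_on_G_space, of U] by simp
    finally show "norm (h x) \<le> 1" .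
  qed simp
  define R where "R \<psi> = (if \<psi> \<in> G_space U then \<psi> h else 0)" for \<psi>
  have R: "R \<in> bounded_ops (G_space U) (G_norm U)"
  proof (rule bounded_opsI)
    show "clinear_on (G_space U) R"
      using subspace_G_space[of U] by (simp add: R_def clinear_on_def complex_vector.subspace_def scaleC_fun_def)
    show "norm (R \<psi>) \<le> sup_norm U h * G_norm U \<psi>" if "\<psi> \<in> G_space U" for \<psi>
      using that G_norm_bound[OF _ h, of \<psi>] G_space_subset[of U] by (auto simp: R_def mult.commute)
  qed (simp add: R_def)
  have "T = R"
    using T R by (rule G_ops_eqI) (simp add: R_def evaluation_in_G_space, simp add: evaluation_def h h_def)
  then have "complex_of_real (atomic_gauge U \<eta> \<phi>) = \<phi> h"
    using L(3) \<phi> by (auto simp: T_def R_def dest: fun_cong[of _ _ \<phi>])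
  then have "\<bar>atomic_gauge U \<eta> \<phi>\<bar> = cmod (\<phi> h)" by (metis norm_of_real)
  also have "\<dots> \<le> G_norm U \<phi> * sup_norm U h" using \<phi> G_space_subset by (intro G_norm_bound h) auto
  also have "\<dots> \<le> G_norm U \<phi> * 1"
    using h1 normed_space_on_nonneg[OF normed_space_on_G_space \<phi>] by (rule mult_left_mono)
  finally show ?thesis by simp
qed

end

text \<open>
  Up to \<open>\<epsilon>\<close>, this says that the unit ball of the predual is the closed absolutely convex hull of the
  evaluations. Errors are relative to the norm of \<open>\<phi>\<close>, so that they pass through homogeneous expressions such
  as \<open>\<ell>\<^sub>p\<close> norms as a common factor.
\<close>

theorem atomic_approximation:
  assumes U: "open U" and \<phi>: "\<phi> \<in> G_space U" and e: "0 < \<epsilon>"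
  obtains \<psi> where "atomic_le U \<psi> ((1 + \<epsilon>) * G_norm U \<phi>)" "G_norm U (\<phi> - \<psi>) \<le> \<epsilon> * G_norm U \<phi>"
proof (cases "\<phi> = 0")
  case True
  then show thesis
    using atomic_le_zero[of U] normed_space_on_zero[OF normed_space_on_G_space, of U] by (intro that[of 0]) auto
next
  case False
  note G = normed_space_on_G_space[of U]
  have pos: "0 < G_norm U \<phi>"
    using False normed_space_on_eq_0_iff[OF G \<phi>] normed_space_on_nonneg[OF G \<phi>] by simp
  \<comment> \<open>The rest is bounded by \<open>\<eta>\<close> times the gauge estimate \<open>(1 + \<epsilon>) * G_norm U \<phi>\<close>.\<close>
  define \<eta> where "\<eta> = \<epsilon> / (1 + \<epsilon>)"
  have \<eta>: "0 < \<eta>" using e by (simp add: \<eta>_def)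
  have "atomic_gauge U \<eta> \<phi> < (1 + \<epsilon>) * G_norm U \<phi>"
    using atomic_gauge_le_G_norm[OF \<eta> U \<phi>] mult_pos_pos[OF e pos] by (simp add: algebra_simps)
  then obtain \<psi> s where a: "atomic_le U \<psi> s" "s + G_norm U (\<phi> - \<psi>) / \<eta> < (1 + \<epsilon>) * G_norm U \<phi>"
    unfolding atomic_gauge_def using atomic_le_zero[of U] by (subst (asm) cInf_less_iff) (auto intro: bdd_belowI[of _ 0] atomic_gauge_set_nonneg[OF \<eta> \<phi>])
  have nn: "0 \<le> G_norm U (\<phi> - \<psi>)" using \<phi> a(1) by (rule G_norm_diff_atomic_nonneg)
  then have "s \<le> (1 + \<epsilon>) * G_norm U \<phi>" using a(2) divide_nonneg_pos[OF nn \<eta>] by linarith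
  then have "atomic_le U \<psi> ((1 + \<epsilon>) * G_norm U \<phi>)" using a(1) unfolding atomic_le_def by force
  moreover have "G_norm U (\<phi> - \<psi>) / \<eta> \<le> (1 + \<epsilon>) * G_norm U \<phi>"
    using a(2) atomic_le_nonneg[OF a(1)] by linarith
  then have "G_norm U (\<phi> - \<psi>) \<le> \<eta> * ((1 + \<epsilon>) * G_norm U \<phi>)" using \<eta> by (simp add: pos_divide_le_eq mult.commute)
  then have "G_norm U (\<phi> - \<psi>) \<le> \<epsilon> * G_norm U \<phi>" using e by (simp add: \<eta>_def)
  ultimately show thesis by (rule that)
qed

section \<open>Finite sequence norms\<close>

text \<open>
  The norm of a finite family over an arbitrary index set, needed because splitting the entries of a
  sequence leads to pairs as indices. The inserted \<open>0\<close> serves the empty family.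
\<close>

definition lp_set :: "ereal \<Rightarrow> 'i set \<Rightarrow> ('i \<Rightarrow> real) \<Rightarrow> real" where
  "lp_set p I g =
    (if p = \<infinity> then Max (insert 0 (g ` I))
     else (\<Sum>i\<in>I. g i powr real_of_ereal p) powr (1 / real_of_ereal p))"

lemma lp_norm_eq_lp_set: "lp_norm N p n x = lp_set p {..<n} (\<lambda>i. N (x i))"
  by (simp add: lp_norm_def lp_set_def)

lemma lp_set_reindex:
  assumes "bij_betw e J I"
  shows "lp_set p J (\<lambda>j. g (e j)) = lp_set p I g"
proof -
  have "(\<lambda>j. g (e j)) ` J = g ` I" using bij_betw_imp_surj_on[OF assms] by auto
  then show ?thesis
    using sum.reindex_bij_betw[OF assms, of "\<lambda>i. g i powr real_of_ereal p"] by (simp add: lp_set_def)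
qed

lemma lp_set_nonneg: "finite I \<Longrightarrow> 0 \<le> lp_set p I g"
  by (auto simp: lp_set_def)

lemma ereal_pos_of_one_less: "1 < p \<Longrightarrow> 0 < (p :: ereal)"
  by (cases p) auto

lemma real_of_ereal_pos_finite: "0 < p \<Longrightarrow> p \<noteq> \<infinity> \<Longrightarrow> 0 < real_of_ereal p"
  by (cases p) auto

lemma lp_set_mono:
  assumes I: "finite I" and p: "0 < p" and "\<And>i. i \<in> I \<Longrightarrow> 0 \<le> g i" "\<And>i. i \<in> I \<Longrightarrow> g i \<le> h i"
  shows "lp_set p I g \<le> lp_set p I h"
proof (cases "p = \<infinity>")
  case True
  have "g i \<le> Max (insert 0 (h ` I))" if "i \<in> I" for i
    using assms(4)[OF that] I that by (meson Max_ge finite_imageI finite_insert imageI insertI2 order_trans)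
  moreover have "0 \<le> Max (insert 0 (h ` I))" using I by (intro Max_ge) auto
  ultimately show ?thesis using True I by (auto simp: lp_set_def)
next
  case False
  then have "0 < real_of_ereal p" using p by (intro real_of_ereal_pos_finite)
  then show ?thesis
    using False assms(3,4) by (auto simp: lp_set_def intro!: powr_mono2 sum_mono sum_nonneg)
qed

lemma lp_set_scale:
  assumes I: "finite I" and p: "0 < p" and c: "0 \<le> c" and g: "\<And>i. i \<in> I \<Longrightarrow> 0 \<le> g i"
  shows "lp_set p I (\<lambda>i. c * g i) \<le> c * lp_set p I g"
proof (cases "p = \<infinity>")
  case True
  have "c * g i \<le> c * Max (insert 0 (g ` I))" if "i \<in> I" for i
    using I that c by (intro mult_left_mono Max_ge) auto
  moreover have "0 \<le> c * Max (insert 0 (g ` I))" using I c by (intro mult_nonneg_nonneg Max_ge) auto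
  ultimately show ?thesis using True I by (auto simp: lp_set_def)
next
  case False
  let ?r = "real_of_ereal p"
  have r: "0 < ?r" using p False by (intro real_of_ereal_pos_finite)
  have "(\<Sum>i\<in>I. (c * g i) powr ?r) = c powr ?r * (\<Sum>i\<in>I. g i powr ?r)"
    using c g by (auto simp: powr_mult sum_distrib_left intro!: sum.cong)
  then have "lp_set p I (\<lambda>i. c * g i) = (c powr ?r) powr (1 / ?r) * lp_set p I g"
    using False by (simp add: lp_set_def powr_mult sum_nonneg)
  also have "(c powr ?r) powr (1 / ?r) = c" using r c by (simp add: powr_powr)
  finally show ?thesis by simp
qed

text \<open>
  Distributing the weight of each entry in proportions \<open>t i u\<close> does not increase the norm if the
  proportions are raised to the power \<open>1 / p\<close>. For \<open>p = \<infinity>\<close> this exponent is \<open>0\<close>, because \<open>real_of_ereal\<close> maps \<open>\<infinity>\<close> to \<open>0\<close>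
  and division by \<open>0\<close> gives \<open>0\<close>; this is the right limiting value.
\<close>

lemma lp_set_split:
  assumes I: "finite I" and A: "\<And>i. i \<in> I \<Longrightarrow> finite (A i)" and p: "0 < p"
    and s: "\<And>i. i \<in> I \<Longrightarrow> 0 \<le> s i"
    and t: "\<And>i u. i \<in> I \<Longrightarrow> u \<in> A i \<Longrightarrow> 0 \<le> t i u" "\<And>i. i \<in> I \<Longrightarrow> (\<Sum>u\<in>A i. t i u) \<le> 1"
  shows "lp_set p (Sigma I A) (\<lambda>(i, u). s i * t i u powr (1 / real_of_ereal p)) \<le> lp_set p I s"
proof (cases "p = \<infinity>")
  case True
  have "s i * t i u powr 0 \<le> Max (insert 0 (s ` I))" if "i \<in> I" for i u
  proof -
    have "s i * t i u powr 0 \<le> s i * 1" using s[OF that] by (intro mult_left_mono) auto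
    also have "\<dots> \<le> Max (insert 0 (s ` I))" using I that by (simp add: Max_ge)
    finally show ?thesis .
  qed
  moreover have "0 \<le> Max (insert 0 (s ` I))" using I by (intro Max_ge) auto
  ultimately show ?thesis using True I A by (auto simp: lp_set_def finite_SigmaI)
next
  case False
  let ?r = "real_of_ereal p"
  have r: "0 < ?r" using p False by (intro real_of_ereal_pos_finite)
  have "(\<Sum>(i, u)\<in>Sigma I A. (s i * t i u powr (1 / ?r)) powr ?r) = (\<Sum>i\<in>I. \<Sum>u\<in>A i. s i powr ?r * t i u)"
    using s t r I A by (subst sum.Sigma) (auto simp: powr_mult powr_powr intro!: sum.cong)
  also have "\<dots> \<le> (\<Sum>i\<in>I. s i powr ?r)"
    using t(2) by (intro sum_mono) (simp add: mult_left_le flip: sum_distrib_left)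
  finally have "(\<Sum>(i, u)\<in>Sigma I A. (s i * t i u powr (1 / ?r)) powr ?r) \<le> (\<Sum>i\<in>I. s i powr ?r)" .
  then show ?thesis
    using False r by (auto simp: lp_set_def case_prod_beta intro!: powr_mono2 sum_nonneg)
qed

text \<open>
  Written with reciprocals, the conjugacy relation holds for \<open>p = \<infinity>\<close> too.
\<close>

lemma conjugate_index_exponents:
  assumes "1 < p"
  shows "0 < conjugate_index p" "conjugate_index p \<noteq> \<infinity>"
    "1 / real_of_ereal p + 1 / real_of_ereal (conjugate_index p) = 1"
proof -
  have "0 < conjugate_index p \<and> conjugate_index p \<noteq> \<infinity> \<and> 1 / real_of_ereal p + 1 / real_of_ereal (conjugate_index p) = 1"
  proof (cases p)
    case (real r)
    with assms have r: "1 < r" by simp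
    have "conjugate_index p = ereal (r / (r - 1))"
      using real r by (simp add: conjugate_index_def one_ereal_def divide_ereal_def divide_inverse)
    then show ?thesis using real r by (simp add: field_simps)
  qed (use assms in \<open>auto simp: conjugate_index_def\<close>)
  then show "0 < conjugate_index p" "conjugate_index p \<noteq> \<infinity>"
    "1 / real_of_ereal p + 1 / real_of_ereal (conjugate_index p) = 1" by auto
qed

context
  fixes V :: "'v::complex_vector set" and N :: "'v \<Rightarrow> real" and q :: ereal
  assumes V: "normed_space_on V N" and q: "0 < q"
begin

text \<open>
  The defining supremum is bounded by the strong \<open>\<ell>\<^sub>q\<close> norm of the sequence.
\<close>

lemma weak_lp_norm_upper:
  assumes y: "\<And>i. i < n \<Longrightarrow> y i \<in> V" and \<eta>: "\<eta> \<in> dual V N" "dual_norm V N \<eta> \<le> 1"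
  shows "lp_norm cmod q n (\<lambda>i. \<eta> (y i)) \<le> weak_lp_norm V N q n y"
proof -
  have "lp_norm cmod q n (\<lambda>i. \<zeta> (y i)) \<le> lp_norm N q n y"
    if \<zeta>: "\<zeta> \<in> dual V N" "dual_norm V N \<zeta> \<le> 1" for \<zeta>
    unfolding lp_norm_eq_lp_set
  proof (rule lp_set_mono[OF _ q])
    fix i assume "i \<in> {..<n}"
    then have yi: "y i \<in> V" using y by simp
    show "cmod (\<zeta> (y i)) \<le> N (y i)"
      using dual_norm_bound[OF V \<zeta>(1) yi] mult_right_mono[OF \<zeta>(2) normed_space_on_nonneg[OF V yi]] by simp
  qed auto
  then show ?thesis
    unfolding weak_lp_norm_def using \<eta> by (intro cSup_upper bdd_aboveI2) auto
qed

lemma dual_ball_zero: "0 \<in> dual V N" "dual_norm V N 0 \<le> 1"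
  using normed_space_on_zero[OF normed_space_on_dual[OF V]]
    complex_vector.subspace_0[OF normed_space_on_subspace[OF normed_space_on_dual[OF V]]] by auto

lemma weak_lp_norm_nonneg:
  assumes "\<And>i. i < n \<Longrightarrow> y i \<in> V"
  shows "0 \<le> weak_lp_norm V N q n y"
proof -
  have "0 \<le> lp_norm cmod q n (\<lambda>i. (0 :: 'v \<Rightarrow> complex) (y i))"
    by (simp only: lp_norm_eq_lp_set lp_set_nonneg finite_lessThan)
  also have "\<dots> \<le> weak_lp_norm V N q n y"
    using assms dual_ball_zero by (rule weak_lp_norm_upper)
  finally show ?thesis .
qed

lemma weak_lp_norm_le:
  assumes "\<And>\<eta>. \<eta> \<in> dual V N \<Longrightarrow> dual_norm V N \<eta> \<le> 1 \<Longrightarrow> lp_norm cmod q n (\<lambda>i. \<eta> (y i)) \<le> K"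
  shows "weak_lp_norm V N q n y \<le> K"
  unfolding weak_lp_norm_def using assms dual_ball_zero by (intro cSup_least) blast+

end

abbreviation weakF :: "ereal \<Rightarrow> nat \<Rightarrow> (nat \<Rightarrow> 'f::complex_normed_vector \<Rightarrow> complex) \<Rightarrow> real" where
  "weakF \<equiv> weak_lp_norm dualF dualF_norm"

lemma normed_space_on_dualF: "normed_space_on (dualF :: ('f::complex_normed_vector \<Rightarrow> complex) set) dualF_norm"
  by (rule normed_space_on_dual[OF normed_space_on_UNIV])

section \<open>Transfer of summing constants\<close>

lemma lp_set_singleton: "0 < p \<Longrightarrow> 0 \<le> g i \<Longrightarrow> lp_set p {i} g = g i"
  using real_of_ereal_pos_finite[of p] by (auto simp: lp_set_def powr_powr)

text \<open>
  The defining inequality for one point, tested on a functional that norms the value there. This is why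
  a holomorphic Cohen strongly summing mapping is bounded, and why a vanishing constant forces \<open>f = 0\<close>.
\<close>

lemma cohen_const_norm_bound:
  fixes f :: "'e::complex_banach \<Rightarrow> 'f::complex_banach"
  assumes p: "1 < p" and C: "cohen_const p U f C" and x: "x \<in> U"
  shows "norm (f x) \<le> C"
proof -
  obtain y where y: "y \<in> dualF" "dualF_norm y \<le> 1" "y (f x) = complex_of_real (norm (f x))"
    by (rule norming_functional)
  note q = conjugate_index_exponents(1)[OF p]
  have p0: "0 < p" using p by (rule ereal_pos_of_one_less)
  have C0: "0 \<le> C" using C by (simp add: cohen_const_def)
  have "(\<Sum>i<1::nat. cmod 1 * cmod (y (f x))) \<le> C * lp_norm cmod p 1 (\<lambda>_. 1) * weakF (conjugate_index p) 1 (\<lambda>_. y)"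
    using C[unfolded cohen_const_def, THEN conjunct2, rule_format, of 1 "\<lambda>_. x" "\<lambda>_. y" "\<lambda>_. 1"] x y(1)
    by simp
  moreover have "lp_norm cmod p 1 (\<lambda>_. 1) = 1"
    using p0 by (simp add: lp_norm_eq_lp_set lessThan_Suc lp_set_singleton)
  moreover have "weakF (conjugate_index p) 1 (\<lambda>_. y) \<le> 1"
  proof (rule weak_lp_norm_le[OF normed_space_on_dualF q])
    fix \<eta> :: "('f \<Rightarrow> complex) \<Rightarrow> complex"
    assume \<eta>: "\<eta> \<in> dual dualF dualF_norm" "dual_norm dualF dualF_norm \<eta> \<le> 1"
    have "cmod (\<eta> y) \<le> dual_norm dualF dualF_norm \<eta> * dualF_norm y"
      using normed_space_on_dualF \<eta>(1) y(1) by (rule dual_norm_bound)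
    also have "\<dots> \<le> 1 * 1"
      using \<eta>(2) y(2) normed_space_on_nonneg[OF normed_space_on_dualF y(1)] by (intro mult_mono) auto
    finally show "lp_norm cmod (conjugate_index p) 1 (\<lambda>_. \<eta> y) \<le> 1"
      using q by (simp add: lp_norm_eq_lp_set lessThan_Suc lp_set_singleton)
  qed
  ultimately show ?thesis using y(3) mult_left_mono[OF _ C0, of "weakF (conjugate_index p) 1 (\<lambda>_. y)" 1] by simp
qed

lemma cohen_summing_imp_hol_bdd:
  assumes "1 < p" "cohen_summing p U f"
  shows "f \<in> hol_bdd U"
proof -
  obtain C where "f \<in> hol U" "cohen_const p U f C" using assms(2) by (auto simp: cohen_summing_def)
  then show ?thesis using cohen_const_norm_bound[OF assms(1)] by (blast intro: hol_bddI)
qed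

text \<open>
  The scalars \<open>l i\<close> turn into vectors \<open>l i *\<^sub>C evaluation U (x i)\<close>, whose norms are at most \<open>\<bar>l i\<bar>\<close>.
\<close>

lemma strongly_summing_const_imp_cohen_const:
  fixes T :: "(('e::complex_banach \<Rightarrow> complex) \<Rightarrow> complex) \<Rightarrow> 'f::complex_banach"
  assumes p: "1 < p" and T: "T \<in> bounded_ops (G_space U) (G_norm U)"
    and Tf: "\<And>x. x \<in> U \<Longrightarrow> T (evaluation U x) = f x"
    and C: "strongly_summing_const p (G_space U) (G_norm U) T C"
  shows "cohen_const p U f C"
  unfolding cohen_const_def
proof (intro conjI allI impI)
  show C0: "0 \<le> C" using C by (simp add: strongly_summing_const_def)
  fix n :: nat and l :: "nat \<Rightarrow> complex" and x :: "nat \<Rightarrow> 'e" and y :: "nat \<Rightarrow> 'f \<Rightarrow> complex"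
  assume x: "\<forall>i<n. x i \<in> U" and y: "\<forall>i<n. y i \<in> dualF"
  let ?W = "weakF (conjugate_index p) n y"
  define \<phi> where "\<phi> i = l i *\<^sub>C evaluation U (x i)" for i
  have \<phi>: "\<phi> i \<in> G_space U" if "i < n" for i
    unfolding \<phi>_def using x that
    by (intro complex_vector.subspace_scale[OF subspace_G_space] evaluation_in_G_space) auto
  have p0: "0 < p" using p by (rule ereal_pos_of_one_less)
  have "(\<Sum>i<n. cmod (l i) * cmod (y i (f (x i)))) = (\<Sum>i<n. cmod (y i (T (\<phi> i))))"
  proof (rule sum.cong)
    fix i assume "i \<in> {..<n}"
    then have i: "x i \<in> U" "y i \<in> dualF" using x y by auto
    have "T (\<phi> i) = l i *\<^sub>C f (x i)"
      using clinear_on_scale[OF bounded_ops_clinear[OF T] evaluation_in_G_space[OF i(1)]] i by (simp add: \<phi>_def Tf)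
    then show "cmod (l i) * cmod (y i (f (x i))) = cmod (y i (T (\<phi> i)))"
      using i by (simp add: dual_scale norm_mult)
  qed simp
  also have "\<dots> \<le> C * lp_norm (G_norm U) p n \<phi> * ?W"
    using C[unfolded strongly_summing_const_def] \<phi> y by blast
  also have "\<dots> \<le> C * lp_norm cmod p n l * ?W"
  proof (intro mult_right_mono mult_left_mono C0)
    show "0 \<le> ?W" using y by (intro weak_lp_norm_nonneg normed_space_on_dualF conjugate_index_exponents p) auto
    show "lp_norm (G_norm U) p n \<phi> \<le> lp_norm cmod p n l"
      unfolding lp_norm_eq_lp_set
    proof (rule lp_set_mono[OF _ p0])
      fix i assume "i \<in> {..<n}"
      then have i: "x i \<in> U" "i < n" using x by auto
      show "0 \<le> G_norm U (\<phi> i)" using \<phi>[OF i(2)] by (rule normed_space_on_nonneg[OF normed_space_on_G_space])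
      show "G_norm U (\<phi> i) \<le> cmod (l i)"
        using normed_space_on_scale[OF normed_space_on_G_space evaluation_in_G_space[OF i(1)], of "l i"]
          mult_left_mono[OF G_norm_evaluation_le[OF i(1)], of "cmod (l i)"] by (simp add: \<phi>_def)
    qed simp
  qed
  finally show "(\<Sum>i<n. cmod (l i) * cmod (y i (f (x i)))) \<le> C * lp_norm cmod p n l * ?W" .
qed

lemma cohen_const_finite_set:
  fixes f :: "'e::complex_banach \<Rightarrow> 'f::complex_banach"
  assumes p: "1 < p" and C: "cohen_const p U f C" and I: "finite I"
    and x: "\<And>i. i \<in> I \<Longrightarrow> x i \<in> U" and y: "\<And>i. i \<in> I \<Longrightarrow> y i \<in> dualF"
    and l: "lp_set p I (\<lambda>i. cmod (l i)) \<le> L"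
    and W: "\<And>\<eta>. \<eta> \<in> dual dualF dualF_norm \<Longrightarrow> dual_norm dualF dualF_norm \<eta> \<le> 1 \<Longrightarrow>
      lp_set (conjugate_index p) I (\<lambda>i. cmod (\<eta> (y i))) \<le> W"
  shows "(\<Sum>i\<in>I. cmod (l i) * cmod (y i (f (x i)))) \<le> C * L * W"
proof -
  obtain e where e: "bij_betw e {0..<card I} I" using ex_bij_betw_nat_finite[OF I] by blast
  then have e: "bij_betw e {..<card I} I" by (simp add: atLeast0LessThan)
  have eI: "e k \<in> I" if "k < card I" for k using bij_betw_apply[OF e] that by simp
  note q = conjugate_index_exponents(1)[OF p]
  have C0: "0 \<le> C" using C by (simp add: cohen_const_def)
  let ?w = "weakF (conjugate_index p) (card I) (\<lambda>k. y (e k))"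
  have "(\<Sum>i\<in>I. cmod (l i) * cmod (y i (f (x i))))
      = (\<Sum>k<card I. cmod (l (e k)) * cmod (y (e k) (f (x (e k)))))"
    by (rule sum.reindex_bij_betw[OF e, symmetric])
  also have "\<dots> \<le> C * lp_norm cmod p (card I) (\<lambda>k. l (e k)) * ?w"
    using C[unfolded cohen_const_def, THEN conjunct2, rule_format, of "card I" "\<lambda>k. x (e k)" "\<lambda>k. y (e k)" "\<lambda>k. l (e k)"] x y eI by simp
  also have "\<dots> \<le> C * L * W"
  proof (intro mult_mono order_refl)
    have eq: "lp_norm cmod p (card I) (\<lambda>k. l (e k)) = lp_set p I (\<lambda>i. cmod (l i))"
      unfolding lp_norm_eq_lp_set using lp_set_reindex[OF e, of p "\<lambda>i. cmod (l i)"] .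
    show "lp_norm cmod p (card I) (\<lambda>k. l (e k)) \<le> L" using l eq by simp
    have "0 \<le> L" using l lp_set_nonneg[OF I, of p "\<lambda>i. cmod (l i)"] by linarith
    then show "0 \<le> C * L" using C0 by simp
    show "?w \<le> W"
    proof (rule weak_lp_norm_le[OF normed_space_on_dualF q])
      fix \<eta> :: "('f \<Rightarrow> complex) \<Rightarrow> complex"
      assume "\<eta> \<in> dual dualF dualF_norm" "dual_norm dualF dualF_norm \<eta> \<le> 1"
      from W[OF this] show "lp_norm cmod (conjugate_index p) (card I) (\<lambda>k. \<eta> (y (e k))) \<le> W"
        unfolding lp_norm_eq_lp_set using lp_set_reindex[OF e, of "conjugate_index p" "\<lambda>i. cmod (\<eta> (y i))"] by simp
    qed
    show "0 \<le> C" by (fact C0)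
    show "0 \<le> lp_norm cmod p (card I) (\<lambda>k. l (e k))"
      by (simp add: lp_norm_eq_lp_set lp_set_nonneg)
    show "0 \<le> ?w" using y eI by (intro weak_lp_norm_nonneg normed_space_on_dualF q) auto
  qed
  finally show ?thesis .
qed

text \<open>
  Each \<open>\<phi> i\<close> is replaced by a combination of evaluations \<open>\<Sum>u. c i u *\<^sub>C evaluation U u\<close> whose coefficients
  sum to at most \<open>s i = (1 + \<epsilon>) * G_norm U (\<phi> i)\<close> in absolute value. With \<open>t i u = \<bar>c i u\<bar> / s i\<close>, the
  identity \<open>\<bar>c i u\<bar> = (s i * t i u powr (1 / p)) * t i u powr (1 / q)\<close> for the conjugate index \<open>q\<close> divides each coefficient
  between the scalars and the functionals. By \<open>lp_set_split\<close>, the scalars then have an \<open>\<ell>\<^sub>p\<close> norm of at most that of \<open>s\<close> and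
  the functionals a weak \<open>\<ell>\<^sub>q\<close> norm of at most that of \<open>y\<close>, so that the Cohen inequality for the
  points \<open>u\<close> yields the operator inequality up to a factor and an error which disappear as \<open>\<epsilon>\<close> tends to \<open>0\<close>.
\<close>

lemma cohen_const_imp_strongly_summing_const:
  fixes T :: "(('e::complex_banach \<Rightarrow> complex) \<Rightarrow> complex) \<Rightarrow> 'f::complex_banach"
  assumes U: "open U" and p: "1 < p" and T: "T \<in> bounded_ops (G_space U) (G_norm U)"
    and Tf: "\<And>x. x \<in> U \<Longrightarrow> T (evaluation U x) = f x"
    and C: "cohen_const p U f C"
  shows "strongly_summing_const p (G_space U) (G_norm U) T C"
  unfolding strongly_summing_const_def
proof (intro conjI allI impI)
  show C0: "0 \<le> C" using C by (simp add: cohen_const_def)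
  fix n :: nat and \<phi> :: "nat \<Rightarrow> ('e \<Rightarrow> complex) \<Rightarrow> complex" and y :: "nat \<Rightarrow> 'f \<Rightarrow> complex"
  assume "\<forall>i<n. \<phi> i \<in> G_space U" and "\<forall>i<n. y i \<in> dualF"
  then have \<phi>: "\<And>i. i < n \<Longrightarrow> \<phi> i \<in> G_space U" and y: "\<And>i. i < n \<Longrightarrow> y i \<in> dualF" by auto
  define q where "q = conjugate_index p"
  note q = conjugate_index_exponents[OF p, folded q_def]
  have p0: "0 < p" using p by (rule ereal_pos_of_one_less)
  note G = normed_space_on_G_space[of U] and sub = subspace_G_space[of U] and cl = bounded_ops_clinear[OF T]
  define W where "W = weakF q n y"
  define L where "L = lp_norm (G_norm U) p n \<phi>"
  define K where "K = op_norm (G_space U) (G_norm U) T"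
  define K' where "K' = (\<Sum>i<n. dualF_norm (y i) * (K * G_norm U (\<phi> i)))"
  have W0: "0 \<le> W" unfolding W_def using y by (intro weak_lp_norm_nonneg normed_space_on_dualF q)
  have nn: "0 \<le> G_norm U (\<phi> i)" if "i < n" for i using \<phi>[OF that] by (rule normed_space_on_nonneg[OF G])
  have approx: "(\<Sum>i<n. cmod (y i (T (\<phi> i)))) \<le> C * L * W + \<epsilon> * (C * L * W + K')" if e: "0 < \<epsilon>" for \<epsilon> :: real
  proof -
    define P where "P i A c \<longleftrightarrow> finite A \<and> A \<subseteq> U \<and> (\<Sum>u\<in>A. cmod (c u)) \<le> (1 + \<epsilon>) * G_norm U (\<phi> i) \<and>
        G_norm U (\<phi> i - (\<Sum>u\<in>A. c u *\<^sub>C evaluation U u)) \<le> \<epsilon> * G_norm U (\<phi> i)" for i A c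
    have "\<exists>A c. P i A c" if i: "i < n" for i
    proof -
      obtain \<psi> where "atomic_le U \<psi> ((1 + \<epsilon>) * G_norm U (\<phi> i))" "G_norm U (\<phi> i - \<psi>) \<le> \<epsilon> * G_norm U (\<phi> i)"
        using U \<phi>[OF i] e by (rule atomic_approximation)
      then show ?thesis unfolding P_def atomic_le_def by blast
    qed
    then obtain A c where P: "\<And>i. i < n \<Longrightarrow> P i (A i) (c i)" by metis
    have A: "\<And>i. i < n \<Longrightarrow> finite (A i)" "\<And>i. i < n \<Longrightarrow> A i \<subseteq> U"
      and c: "\<And>i. i < n \<Longrightarrow> (\<Sum>u\<in>A i. cmod (c i u)) \<le> (1 + \<epsilon>) * G_norm U (\<phi> i)"
      and rest: "\<And>i. i < n \<Longrightarrow> G_norm U (\<phi> i - (\<Sum>u\<in>A i. c i u *\<^sub>C evaluation U u)) \<le> \<epsilon> * G_norm U (\<phi> i)"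
      using P by (auto simp: P_def)
    define s where "s i = (1 + \<epsilon>) * G_norm U (\<phi> i)" for i
    define t where "t i u = cmod (c i u) / s i" for i u
    have s0: "0 \<le> s i" if "i < n" for i using nn[OF that] e by (simp add: s_def)
    have t0: "0 \<le> t i u" if "i < n" for i u using s0[OF that] by (simp add: t_def)
    have t1: "(\<Sum>u\<in>A i. t i u) \<le> 1" if "i < n" for i
    proof -
      have "(\<Sum>u\<in>A i. t i u) = (\<Sum>u\<in>A i. cmod (c i u)) / s i" by (simp add: t_def sum_divide_distrib)
      moreover have "(\<Sum>u\<in>A i. cmod (c i u)) \<le> s i" using c[OF that] by (simp add: s_def)
      ultimately show ?thesis using s0[OF that] by (cases "s i = 0") (auto simp: divide_le_eq_1)
    qed
    \<comment> \<open>If \<open>s i = 0\<close>, then \<open>t i u = 0\<close> by the convention for division, and all \<open>c i u\<close> vanish.\<close>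
    have st: "s i * t i u = cmod (c i u)" if "i < n" "u \<in> A i" for i u
    proof (cases "s i = 0")
      case True
      have "cmod (c i u) \<le> (\<Sum>u\<in>A i. cmod (c i u))" using that A by (intro member_le_sum) auto
      also have "\<dots> \<le> 0" using c[OF that(1), folded s_def] True by simp
      finally show ?thesis using True by simp
    qed (simp add: t_def)
    define a where "a = 1 / real_of_ereal p"
    define b where "b = 1 / real_of_ereal q"
    define I where "I = Sigma {..<n} A"
    define l where "l = (\<lambda>(i, u). complex_of_real (s i * t i u powr a))"
    define Y where "Y = (\<lambda>(i, u). complex_of_real (t i u powr b) *\<^sub>C y i)"
    have fI: "finite I" using A by (auto simp: I_def)
    have main: "(\<Sum>k\<in>I. cmod (l k) * cmod (Y k (f (snd k)))) \<le> C * ((1 + \<epsilon>) * L) * W"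
    proof (rule cohen_const_finite_set[OF p C fI])
      show "snd k \<in> U" if "k \<in> I" for k using that A(2)[of "fst k"] by (auto simp: I_def)
      show "Y k \<in> dualF" if "k \<in> I" for k
        using that y by (auto simp: I_def Y_def intro!: complex_vector.subspace_scale[OF normed_space_on_subspace[OF normed_space_on_dualF]])
      have "lp_set p I (\<lambda>k. cmod (l k)) \<le> lp_set p I (\<lambda>(i, u). s i * t i u powr a)"
        using s0 by (intro lp_set_mono fI p0) (auto simp: I_def l_def norm_mult)
      also have "\<dots> \<le> lp_set p {..<n} s"
        unfolding I_def a_def using A s0 t0 t1 by (intro lp_set_split p0) auto
      also have "\<dots> \<le> (1 + \<epsilon>) * L"
        unfolding s_def L_def lp_norm_eq_lp_set using e nn by (intro lp_set_scale p0) auto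
      finally show "lp_set p I (\<lambda>k. cmod (l k)) \<le> (1 + \<epsilon>) * L" .
      fix \<eta> :: "('f \<Rightarrow> complex) \<Rightarrow> complex"
      assume \<eta>: "\<eta> \<in> dual dualF dualF_norm" "dual_norm dualF dualF_norm \<eta> \<le> 1"
      have "lp_set q I (\<lambda>k. cmod (\<eta> (Y k))) \<le> lp_set q I (\<lambda>(i, u). cmod (\<eta> (y i)) * t i u powr b)"
        using clinear_on_scale[OF dual_clinear[OF \<eta>(1)]] y
        by (intro lp_set_mono fI q) (auto simp: I_def Y_def scaleC_complex_def norm_mult)
      also have "\<dots> \<le> lp_set q {..<n} (\<lambda>i. cmod (\<eta> (y i)))"
        unfolding I_def b_def using A t0 t1 by (intro lp_set_split q) auto
      also have "\<dots> \<le> W"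
        using weak_lp_norm_upper[OF normed_space_on_dualF q(1) y \<eta>] by (simp add: W_def lp_norm_eq_lp_set)
      finally show "lp_set (conjugate_index p) I (\<lambda>k. cmod (\<eta> (Y k))) \<le> W" by (simp add: q_def)
    qed
    have "cmod (y i (T (\<phi> i))) \<le>
        (\<Sum>u\<in>A i. cmod (l (i, u)) * cmod (Y (i, u) (f u))) + \<epsilon> * (dualF_norm (y i) * (K * G_norm U (\<phi> i)))"
      if i: "i < n" for i
    proof -
      define \<psi> where "\<psi> = (\<Sum>u\<in>A i. c i u *\<^sub>C evaluation U u)"
      have \<psi>: "\<psi> \<in> G_space U" unfolding \<psi>_def using A(2)[OF i]
        by (intro complex_vector.subspace_sum[OF sub] complex_vector.subspace_scale[OF sub] evaluation_in_G_space) auto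
      have "T \<psi> = (\<Sum>u\<in>A i. T (c i u *\<^sub>C evaluation U u))"
        unfolding \<psi>_def using A(2)[OF i]
        by (intro clinear_on_sum[OF cl sub] complex_vector.subspace_scale[OF sub] evaluation_in_G_space) auto
      also have "\<dots> = (\<Sum>u\<in>A i. c i u *\<^sub>C f u)"
        using A(2)[OF i] by (intro sum.cong) (auto simp: clinear_on_scale[OF cl] evaluation_in_G_space Tf)
      finally have T\<psi>: "y i (T \<psi>) = (\<Sum>u\<in>A i. c i u * y i (f u))"
        by (simp add: dual_sum[OF y[OF i]] dual_scale[OF y[OF i]])
      have terms: "cmod (c i u * y i (f u)) = cmod (l (i, u)) * cmod (Y (i, u) (f u))" if u: "u \<in> A i" for u
      proof -
        have "t i u powr a * t i u powr b = t i u"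
          using q(3) t0[OF i] by (simp add: a_def b_def powr_add[symmetric])
        then have "s i * t i u powr a * t i u powr b = cmod (c i u)"
          using st[OF i u] by (simp add: mult.assoc)
        then show ?thesis
          using s0[OF i] by (simp add: l_def Y_def norm_mult scaleC_fun_def scaleC_complex_def mult.assoc[symmetric])
      qed
      have "cmod (y i (T \<psi>)) \<le> (\<Sum>u\<in>A i. cmod (l (i, u)) * cmod (Y (i, u) (f u)))"
        unfolding T\<psi> using terms by (intro order_trans[OF norm_sum]) simp
      moreover have "cmod (y i (T (\<phi> i - \<psi>))) \<le> \<epsilon> * (dualF_norm (y i) * (K * G_norm U (\<phi> i)))"
      proof -
        have "norm (T (\<phi> i - \<psi>)) \<le> K * G_norm U (\<phi> i - \<psi>)"
          unfolding K_def using \<phi>[OF i] \<psi> by (intro op_norm_bound[OF G T] complex_vector.subspace_diff[OF sub])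
        also have "\<dots> \<le> K * (\<epsilon> * G_norm U (\<phi> i))"
          unfolding K_def \<psi>_def using rest[OF i] by (intro mult_left_mono op_norm_nonneg[OF G T])
        finally have "dualF_norm (y i) * norm (T (\<phi> i - \<psi>)) \<le> dualF_norm (y i) * (K * (\<epsilon> * G_norm U (\<phi> i)))"
          using normed_space_on_nonneg[OF normed_space_on_dualF y[OF i]] by (intro mult_left_mono)
        with cmod_dual_le[OF y[OF i], of "T (\<phi> i - \<psi>)"] show ?thesis by (simp add: algebra_simps)
      qed
      moreover have "y i (T (\<phi> i)) = y i (T \<psi>) + y i (T (\<phi> i - \<psi>))"
        using clinear_on_diff[OF cl sub \<phi>[OF i] \<psi>] by (simp add: dual_diff[OF y[OF i]])
      ultimately show ?thesis using norm_triangle_ineq[of "y i (T \<psi>)" "y i (T (\<phi> i - \<psi>))"] by simp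
    qed
    then have "(\<Sum>i<n. cmod (y i (T (\<phi> i)))) \<le>
        (\<Sum>i<n. (\<Sum>u\<in>A i. cmod (l (i, u)) * cmod (Y (i, u) (f u))) + \<epsilon> * (dualF_norm (y i) * (K * G_norm U (\<phi> i))))"
      by (intro sum_mono) auto
    also have "\<dots> = (\<Sum>k\<in>I. cmod (l k) * cmod (Y k (f (snd k)))) + \<epsilon> * K'"
    proof -
      have "(\<Sum>i<n. \<Sum>u\<in>A i. cmod (l (i, u)) * cmod (Y (i, u) (f u)))
          = (\<Sum>(i, u)\<in>I. cmod (l (i, u)) * cmod (Y (i, u) (f u)))"
        unfolding I_def using A by (intro sum.Sigma) auto
      also have "\<dots> = (\<Sum>k\<in>I. cmod (l k) * cmod (Y k (f (snd k))))"
        by (rule sum.cong) auto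
      finally show ?thesis by (simp only: sum.distrib K'_def sum_distrib_left)
    qed
    also have "\<dots> \<le> C * ((1 + \<epsilon>) * L) * W + \<epsilon> * K'" using main by simp
    finally show ?thesis by (simp add: algebra_simps)
  qed
  have "((\<lambda>\<epsilon>. C * L * W + \<epsilon> * (C * L * W + K')) \<longlongrightarrow> C * L * W + 0 * (C * L * W + K')) (at_right 0)"
    by (intro tendsto_intros)
  then have "(\<Sum>i<n. cmod (y i (T (\<phi> i)))) \<le> C * L * W + 0 * (C * L * W + K')"
    by (rule tendsto_lowerbound[OF _ eventually_mono[OF eventually_at_right_less approx]])
      (simp_all add: trivial_limit_at_right_real)
  then show "(\<Sum>i<n. cmod (y i (T (\<phi> i)))) \<le> C * lp_norm (G_norm U) p n \<phi> * weakF (conjugate_index p) n y"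
    by (simp add: L_def W_def q_def)
qed

section \<open>The isometric isomorphism\<close>

lemma cohen_const_linearization_iff:
  fixes f :: "'e::complex_banach \<Rightarrow> 'f::complex_banach"
  assumes "open U" "1 < p" "f \<in> hol_bdd U"
  shows "strongly_summing_const p (G_space U) (G_norm U) (linearization U f) C \<longleftrightarrow> cohen_const p U f C"
  using strongly_summing_const_imp_cohen_const cohen_const_imp_strongly_summing_const
    linearization_in[OF assms(3)] linearization_evaluation[OF assms(3)] assms by blast

lemma cohen_summing_linearization_iff:
  fixes f :: "'e::complex_banach \<Rightarrow> 'f::complex_banach"
  assumes "open U" "1 < p" "f \<in> hol_bdd U"
  shows "strongly_summing p (G_space U) (G_norm U) (linearization U f) \<longleftrightarrow> cohen_summing p U f"
  using linearization_in[OF assms(3)] hol_bdd_imp_hol[OF assms(3)]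
  by (simp add: strongly_summing_def cohen_summing_def cohen_const_linearization_iff[OF assms])

lemma strongly_summing_norm_linearization:
  fixes f :: "'e::complex_banach \<Rightarrow> 'f::complex_banach"
  assumes "open U" "1 < p" "f \<in> hol_bdd U"
  shows "strongly_summing_norm p (G_space U) (G_norm U) (linearization U f) = cohen_norm p U f"
  by (simp add: strongly_summing_norm_def cohen_norm_def cohen_const_linearization_iff[OF assms])

lemma cohen_const_scale:
  assumes f: "cohen_const p U f C"
  shows "cohen_const p U (a *\<^sub>C f) (cmod a * C)"
  unfolding cohen_const_def
proof (intro conjI allI impI)
  show "0 \<le> cmod a * C" using f by (simp add: cohen_const_def)
  fix n :: nat and l :: "nat \<Rightarrow> complex" and x :: "nat \<Rightarrow> 'a" and y :: "nat \<Rightarrow> 'b \<Rightarrow> complex"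
  assume x: "\<forall>i<n. x i \<in> U" and y: "\<forall>i<n. y i \<in> dualF"
  have "(\<Sum>i<n. cmod (l i) * cmod (y i ((a *\<^sub>C f) (x i)))) = cmod a * (\<Sum>i<n. cmod (l i) * cmod (y i (f (x i))))"
    using y by (auto simp: scaleC_fun_def dual_scale norm_mult sum_distrib_left intro!: sum.cong)
  also have "\<dots> \<le> cmod a * (C * lp_norm cmod p n l * weakF (conjugate_index p) n y)"
    using f x y by (intro mult_left_mono) (simp_all add: cohen_const_def)
  finally show "(\<Sum>i<n. cmod (l i) * cmod (y i ((a *\<^sub>C f) (x i))))
      \<le> cmod a * C * lp_norm cmod p n l * weakF (conjugate_index p) n y"
    by (simp add: mult.assoc)
qed

lemma cohen_const_add:
  assumes f: "cohen_const p U f C" and g: "cohen_const p U g D"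
  shows "cohen_const p U (f + g) (C + D)"
  unfolding cohen_const_def
proof (intro conjI allI impI)
  show "0 \<le> C + D" using f g by (simp add: cohen_const_def)
  fix n :: nat and l :: "nat \<Rightarrow> complex" and x :: "nat \<Rightarrow> 'a" and y :: "nat \<Rightarrow> 'b \<Rightarrow> complex"
  assume x: "\<forall>i<n. x i \<in> U" and y: "\<forall>i<n. y i \<in> dualF"
  let ?P = "lp_norm cmod p n l" and ?W = "weakF (conjugate_index p) n y"
  have "(\<Sum>i<n. cmod (l i) * cmod (y i ((f + g) (x i))))
      \<le> (\<Sum>i<n. cmod (l i) * cmod (y i (f (x i))) + cmod (l i) * cmod (y i (g (x i))))"
    using y by (intro sum_mono) (auto simp: dual_add norm_triangle_ineq simp flip: distrib_left intro!: mult_left_mono)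
  also have "\<dots> \<le> C * ?P * ?W + D * ?P * ?W"
    unfolding sum.distrib using f g x y by (intro add_mono) (simp_all add: cohen_const_def)
  finally show "(\<Sum>i<n. cmod (l i) * cmod (y i ((f + g) (x i)))) \<le> (C + D) * ?P * ?W"
    by (simp add: algebra_simps)
qed

text \<open>
  The infimum is attained since the admissible constants are given by non-strict inequalities that are linear in the
  constant.
\<close>

lemma cohen_const_cohen_norm:
  fixes f :: "'e::complex_banach \<Rightarrow> 'f::complex_banach"
  assumes p: "1 < p" and f: "cohen_summing p U f"
  shows "cohen_const p U f (cohen_norm p U f)"
  unfolding cohen_const_def
proof (intro conjI allI impI)
  obtain C0 where C0: "cohen_const p U f C0" using f by (auto simp: cohen_summing_def)
  then have ne: "{C. cohen_const p U f C} \<noteq> {}" by blast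
  show "0 \<le> cohen_norm p U f"
    unfolding cohen_norm_def using ne by (rule cInf_greatest) (simp add: cohen_const_def)
  fix n :: nat and l :: "nat \<Rightarrow> complex" and x :: "nat \<Rightarrow> 'e" and y :: "nat \<Rightarrow> 'f \<Rightarrow> complex"
  assume x: "\<forall>i<n. x i \<in> U" and y: "\<forall>i<n. y i \<in> dualF"
  let ?S = "\<Sum>i<n. cmod (l i) * cmod (y i (f (x i)))"
  define B where "B = lp_norm cmod p n l * weakF (conjugate_index p) n y"
  have B: "0 \<le> B"
    unfolding B_def using y
    by (intro mult_nonneg_nonneg weak_lp_norm_nonneg normed_space_on_dualF conjugate_index_exponents[OF p])
      (auto simp: lp_norm_eq_lp_set lp_set_nonneg)
  have S: "?S \<le> C * B" if "cohen_const p U f C" for C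
    using that x y by (simp add: cohen_const_def B_def mult.assoc)
  have "?S \<le> cohen_norm p U f * B"
  proof (cases "B = 0")
    case True
    then show ?thesis using S[OF C0] by simp
  next
    case False
    with B have B: "0 < B" by simp
    have "?S / B \<le> cohen_norm p U f"
      unfolding cohen_norm_def using ne by (rule cInf_greatest) (use S B in \<open>simp add: pos_divide_le_eq\<close>)
    then show ?thesis using B by (simp add: pos_divide_le_eq)
  qed
  then show "?S \<le> cohen_norm p U f * lp_norm cmod p n l * weakF (conjugate_index p) n y"
    by (simp add: B_def mult.assoc)
qed

lemma cohen_norm_le: "cohen_const p U f C \<Longrightarrow> cohen_norm p U f \<le> C"
  unfolding cohen_norm_def by (intro cInf_lower bdd_belowI[of _ 0]) (auto simp: cohen_const_def)

lemma normed_space_on_cohen_summing: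
  assumes p: "1 < p"
  shows "normed_space_on {g :: 'e::complex_banach \<Rightarrow> 'f::complex_banach. cohen_summing p U g} (cohen_norm p U)"
proof -
  let ?S = "{g :: 'e \<Rightarrow> 'f. cohen_summing p U g}"
  note const = cohen_const_cohen_norm[OF p]
  have hol: "g \<in> hol U" if "g \<in> ?S" for g using that by (simp add: cohen_summing_def)
  have nn: "0 \<le> cohen_norm p U g" if "g \<in> ?S" for g using const that by (auto simp: cohen_const_def)
  have zero_const: "cohen_const p U (0 :: 'e \<Rightarrow> 'f) 0"
    by (auto simp: cohen_const_def dual_zero intro!: sum_nonpos)
  have zero: "0 \<in> ?S"
    using zero_const complex_vector.subspace_0[OF subspace_hol] by (auto simp: cohen_summing_def)
  have add: "f + g \<in> ?S \<and> cohen_norm p U (f + g) \<le> cohen_norm p U f + cohen_norm p U g" if "f \<in> ?S" "g \<in> ?S" for f g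
    using cohen_const_add[OF const const] complex_vector.subspace_add[OF subspace_hol hol hol] that
    by (auto simp: cohen_summing_def[of p U "f + g"] intro: cohen_norm_le)
  have scale: "a *\<^sub>C f \<in> ?S \<and> cohen_norm p U (a *\<^sub>C f) \<le> cmod a * cohen_norm p U f" if "f \<in> ?S" for a f
    using cohen_const_scale[OF const] complex_vector.subspace_scale[OF subspace_hol hol] that
    by (auto simp: cohen_summing_def[of p U "a *\<^sub>C f"] intro: cohen_norm_le)
  have scale_eq: "cohen_norm p U (a *\<^sub>C f) = cmod a * cohen_norm p U f" if f: "f \<in> ?S" for a f
  proof (cases "a = 0")
    case True
    then show ?thesis using scale[OF f, of 0] nn[of "0 *\<^sub>C f"] by fastforce
  next
    case False
    have "cohen_norm p U (inverse a *\<^sub>C a *\<^sub>C f) \<le> cmod (inverse a) * cohen_norm p U (a *\<^sub>C f)"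
      using scale[OF conjunct1[OF scale[OF f]]] by blast
    then have "cmod a * cohen_norm p U f \<le> cohen_norm p U (a *\<^sub>C f)"
      using False by (simp add: norm_inverse norm_divide field_simps)
    with scale[OF f, of a] show ?thesis by force
  qed
  have eq0: "cohen_norm p U f = 0 \<longleftrightarrow> f = 0" if f: "f \<in> ?S" for f
  proof
    assume "cohen_norm p U f = 0"
    then have "f x = 0" for x
      using cohen_const_norm_bound[OF p const, of U f x] hol_outside[OF hol[OF f], of x] f by (cases "x \<in> U") auto
    then show "f = 0" by (simp add: fun_eq_iff)
  next
    assume "f = 0"
    then show "cohen_norm p U f = 0" using scale_eq[OF zero, of 0] by simp
  qed
  show ?thesis
    unfolding normed_space_on_def complex_vector.subspace_def
    using zero add scale scale_eq eq0 nn by auto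
qed

text \<open>
  The target inherits its normed structure through \<open>\<Phi>\<close>, so only the source has to be checked.
\<close>

lemma isometric_isomorphismI:
  assumes V: "normed_space_on V N" and \<Phi>: "clinear_on V \<Phi>" "bij_betw \<Phi> V W"
    and iso: "\<And>x. x \<in> V \<Longrightarrow> M (\<Phi> x) = N x"
  shows "isometric_isomorphism V N W M \<Phi>"
proof -
  note sub = normed_space_on_subspace[OF V]
  have W: "W = \<Phi> ` V" and inj: "inj_on \<Phi> V" using \<Phi>(2) by (auto simp: bij_betw_def)
  have zero: "\<Phi> 0 = 0" using \<Phi>(1) sub by (rule clinear_on_zero)
  have "complex_vector.subspace W"
    unfolding complex_vector.subspace_def W
  proof (intro conjI ballI allI)
    show "0 \<in> \<Phi> ` V" using zero complex_vector.subspace_0[OF sub] by (metis imageI)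
  next
    fix u v assume "u \<in> \<Phi> ` V" "v \<in> \<Phi> ` V"
    then obtain x y where "x \<in> V" "y \<in> V" "u = \<Phi> x" "v = \<Phi> y" by blast
    then show "u + v \<in> \<Phi> ` V"
      using clinear_on_add[OF \<Phi>(1), of x y] complex_vector.subspace_add[OF sub, of x y] by (metis imageI)
  next
    fix a u assume "u \<in> \<Phi> ` V"
    then obtain x where "x \<in> V" "u = \<Phi> x" by blast
    then show "a *\<^sub>C u \<in> \<Phi> ` V"
      using clinear_on_scale[OF \<Phi>(1), of x a] complex_vector.subspace_scale[OF sub, of x a] by (metis imageI)
  qed
  moreover have "\<Phi> x = 0 \<longleftrightarrow> x = 0" if "x \<in> V" for x
    using inj that complex_vector.subspace_0[OF sub] zero by (metis inj_onD)
  ultimately have "normed_space_on W M"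
    using V iso clinear_on_add[OF \<Phi>(1), symmetric] clinear_on_scale[OF \<Phi>(1), symmetric]
      complex_vector.subspace_add[OF sub] complex_vector.subspace_scale[OF sub]
    by (simp add: normed_space_on_def W)
  then show ?thesis using assms by (simp add: isometric_isomorphism_def)
qed

lemma linearization_clinear_on: "clinear_on (hol_bdd U) (linearization U)"
  unfolding clinear_on_def
proof (intro conjI ballI allI)
  note ops = normed_space_on_subspace[OF normed_space_on_bounded_ops[OF normed_space_on_G_space]]
  fix f :: "'a \<Rightarrow> 'b" assume f: "f \<in> hol_bdd U"
  show "linearization U (f + g) = linearization U f + linearization U g" if g: "g \<in> hol_bdd U" for g
    by (rule linearization_eqI)
      (simp_all add: f g linearization_in linearization_evaluation complex_vector.subspace_add[OF ops])
  show "linearization U (a *\<^sub>C f) = a *\<^sub>C linearization U f" for a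
  proof (rule linearization_eqI)
    show "a *\<^sub>C linearization U f \<in> bounded_ops (G_space U) (G_norm U)"
      by (intro complex_vector.subspace_scale[OF ops] linearization_in f)
  qed (simp add: f linearization_evaluation scaleC_fun_def)
qed

text \<open>
  Injectivity is evaluation at the points of \<open>U\<close>. Surjectivity rests on the holomorphy of the evaluation map: it makes
  \<open>x \<mapsto> T (evaluation U x)\<close> a mapping whose linearization is \<open>T\<close>.
\<close>

lemma linearization_bij_betw:
  assumes U: "open U" and p: "1 < p"
  shows "bij_betw (linearization U) {g :: 'e::complex_banach \<Rightarrow> 'f::complex_banach. cohen_summing p U g}
    {T. strongly_summing p (G_space U) (G_norm U) T}"
  unfolding bij_betw_def
proof (intro conjI)
  note bdd = cohen_summing_imp_hol_bdd[OF p]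
  show "inj_on (linearization U) {g :: 'e \<Rightarrow> 'f. cohen_summing p U g}"
  proof (rule inj_onI, rule ext)
    fix f g :: "'e \<Rightarrow> 'f" and x
    assume fg: "f \<in> {g. cohen_summing p U g}" "g \<in> {g. cohen_summing p U g}" and eq: "linearization U f = linearization U g"
    then have f: "f \<in> hol_bdd U" and g: "g \<in> hol_bdd U" using bdd by auto
    show "f x = g x"
      using eq linearization_evaluation[OF f, of x] linearization_evaluation[OF g, of x]
        hol_outside[OF hol_bdd_imp_hol[OF f], of x] hol_outside[OF hol_bdd_imp_hol[OF g], of x]
      by (cases "x \<in> U") auto
  qed
  have "linearization U g \<in> {T. strongly_summing p (G_space U) (G_norm U) T}" if "cohen_summing p U g" for g :: "'e \<Rightarrow> 'f"
    using cohen_summing_linearization_iff[OF U p bdd[OF that]] that by simp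
  moreover have "T \<in> linearization U ` {g :: 'e \<Rightarrow> 'f. cohen_summing p U g}"
    if T: "strongly_summing p (G_space U) (G_norm U) T" for T
  proof -
    have ops: "T \<in> bounded_ops (G_space U) (G_norm U)" using T by (simp add: strongly_summing_def)
    define g where "g x = (if x \<in> U then T (evaluation U x) else 0)" for x
    have g: "g \<in> hol_bdd U" using G_op_evaluation_hol_bdd[OF U ops] by (simp add: g_def[abs_def])
    have lin: "linearization U g = T" using ops by (rule linearization_eqI) (simp add: g_def)
    have "cohen_summing p U g" using cohen_summing_linearization_iff[OF U p g] T by (simp add: lin)
    with lin show ?thesis by blast
  qed
  ultimately show "linearization U ` {g :: 'e \<Rightarrow> 'f. cohen_summing p U g} = {T. strongly_summing p (G_space U) (G_norm U) T}"
    by blast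
qed

theorem theorem5p3:
  fixes U :: "'e::complex_banach set"
    and f :: "'e \<Rightarrow> 'f::complex_banach"
    and p :: ereal
  assumes "open U"
    and "1 < p" and "p \<le> \<infinity>"
    and "f \<in> hol_bdd U"
  shows "(cohen_summing p U f \<longleftrightarrow>
            strongly_summing p (G_space U) (G_norm U) (linearization U f)) \<and>
         (cohen_summing p U f \<longrightarrow>
            strongly_summing_norm p (G_space U) (G_norm U) (linearization U f) =
              cohen_norm p U f) \<and>
         isometric_isomorphism
           {g :: 'e \<Rightarrow> 'f. cohen_summing p U g} (cohen_norm p U)
           {T :: (('e \<Rightarrow> complex) \<Rightarrow> complex) \<Rightarrow> 'f.
              strongly_summing p (G_space U) (G_norm U) T}
           (strongly_summing_norm p (G_space U) (G_norm U))
           (linearization U)"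
proof (intro conjI impI)
  note bdd = cohen_summing_imp_hol_bdd[OF \<open>1 < p\<close>]
  show "cohen_summing p U f \<longleftrightarrow> strongly_summing p (G_space U) (G_norm U) (linearization U f)"
    using cohen_summing_linearization_iff[OF assms(1,2,4)] by simp
  show "strongly_summing_norm p (G_space U) (G_norm U) (linearization U f) = cohen_norm p U f"
    using assms(1,2,4) by (rule strongly_summing_norm_linearization)
  show "isometric_isomorphism
           {g :: 'e \<Rightarrow> 'f. cohen_summing p U g} (cohen_norm p U)
           {T :: (('e \<Rightarrow> complex) \<Rightarrow> complex) \<Rightarrow> 'f.
              strongly_summing p (G_space U) (G_norm U) T}
           (strongly_summing_norm p (G_space U) (G_norm U))
           (linearization U)"
  proof (rule isometric_isomorphismI)
    show "normed_space_on {g :: 'e \<Rightarrow> 'f. cohen_summing p U g} (cohen_norm p U)"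
      using assms(2) by (rule normed_space_on_cohen_summing)
    show "clinear_on {g :: 'e \<Rightarrow> 'f. cohen_summing p U g} (linearization U)"
      using bdd by (intro clinear_on_subset[OF linearization_clinear_on]) auto
    show "bij_betw (linearization U) {g :: 'e \<Rightarrow> 'f. cohen_summing p U g}
        {T. strongly_summing p (G_space U) (G_norm U) T}"
      using assms(1,2) by (rule linearization_bij_betw)
    show "strongly_summing_norm p (G_space U) (G_norm U) (linearization U g) = cohen_norm p U g"
      if "g \<in> {g :: 'e \<Rightarrow> 'f. cohen_summing p U g}" for g
      using strongly_summing_norm_linearization[OF assms(1,2) bdd] that by simp
  qed
qed

end
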